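(* Let $(X,d)$ be a compact metric space and $f:X\to X$ a continuous map with the almost specification property. Let $\varphi:X\to\mathbb{R}$ be a continuous function satisfying $$\inf_{\mu\in\mathcal{M}_f(X)}\int\varphi\,d\mu<\sup_{\mu\in\mathcal{M}_f(X)}\int\varphi\,d\mu .$$ Let $$\widehat X(\varphi,f):=\Big\{x\in X:\lim_{n\to\infty}\frac1n\sum_{i=0}^{n-1}\varphi(f^i(x))\text{ does not exist}\Big\}.$$ Then $h_{top}(\widehat X(\varphi,f))=h_{top}(f)$.
   Context: $\mathcal{M}_f(X)$ is the set of $f$-invariant Borel probability measures on $X$. $h_{top}(f)$ is the usual topological entropy of $(X,f)$. **Mistake functions.** Let $\epsilon_0>0$. A function $g:\mathbb{N}\times(0,\epsilon_0]\to\mathbb{N}$ is a mistake function if for all $\epsilon\in(0,\epsilon_0]$ and $n\in\mathbb{N}$, $g(n,\epsilon)\le g(n+1,\epsilon)$, and $\lim_{n\to\infty}g(n,\epsilon)/n=0$. For $\epsilon>\epsilon_0$ put $g(n,\epsilon):=g(n,\epsilon_0)$. **Balls with mistakes.** For $\epsilon>0$ and $n$ with $g(n,\epsilon)<n$, let $I(g;n,\epsilon)=\{\Lambda\subseteq\{0,\dots,n-1\}:\#\Lambda\ge n-g(n,\epsilon)\}$. For a finite set of indices $\Lambda$ let $d_\Lambda(x,y)=\max\{d(f^jx,f^jy):j\in\Lambda\}$ and $B_\Lambda(x,\epsilon)=\{y\in X:d_\Lambda(x,y)<\epsilon\}$. Put $B_n(g;x,\epsilon)=\bigcup_{\Lambda\in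 I(g;n,\epsilon)}B_\Lambda(x,\epsilon)$. **Almost specification.** A continuous map $f:X\to X$ has the almost specification property if there is a mistake function $g$ such that for any $\epsilon_1,\dots,\epsilon_k>0$ there exist integers $N(g,\epsilon_1),\dots,N(g,\epsilon_k)$ (where $N(g,\epsilon)$ depends only on $g$ and $\epsilon$, and is large enough that $g(n,\epsilon)<n$ for all $n\ge N(g,\epsilon)$) such that for any $x_1,\dots,x_k\in X$ and integers $n_i\ge N(g,\epsilon_i)$, $$\bigcap_{j=1}^k f^{-\sum_{i=0}^{j-1}n_i}B_{n_j}(g;x_j,\epsilon_j)\ne\emptyset,\qquad n_0:=0.$$ **Entropy of a subset (Bowen).** Let $B_n(x,\epsilon)=\{y\in X:d(f^ix,f^iy)<\epsilon,\ 0\le i\le n-1\}$. For a Borel set $Z\subset X$ (not necessarily compact or invariant), $\alpha\in\mathbb{R}$, $\epsilon>0$, $N\in\mathbb{N}$, let $M(Z,\alpha,\epsilon,N)=\inf_\Gamma\sum_{i}e^{-\alpha n_i}$, the infimum being over all finite or countable collections $\Gamma=\{B_{n_i}(x_i,\epsilon)\}_i$ covering $Z$ with $x_i\in X$ and all $n_i\ge N$. Let $m(Z,\alpha,\epsilon)=\lim_{N\to\infty}M(Z,\alpha,\epsilon,N)$, $h_{top}(Z,\epsilon)=\inf\{\alpha:m(Z,\alpha,\epsilon)=0\}=\sup\{\alpha:m(Z,\alpha,\epsilon)=\infty\}$, and $h_{top}(Z)=\lim_{\epsilon\to0}h_{top}(Z,\epsilon)$. *)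

theory Defs
  imports "HOL-Probability.Probability"
begin

text \<open>
  The compact metric space is the whole type, i.e. a type of class \<open>metric_space\<close> whose
  \<open>UNIV\<close> is compact. The iterate of \<open>f\<close> is \<open>f ^^ n\<close>.
\<close>

definition invariant_measures :: "('a::metric_space \<Rightarrow> 'a) \<Rightarrow> 'a measure set" where
  "invariant_measures f =
     {\<mu>. prob_space \<mu> \<and> sets \<mu> = sets borel \<and>
         (\<forall>A\<in>sets borel. emeasure \<mu> (f -` A) = emeasure \<mu> A)}"

definition irregular_set :: "('a \<Rightarrow> 'a) \<Rightarrow> ('a \<Rightarrow> real) \<Rightarrow> 'a set" where
  "irregular_set f \<phi> = {x. \<not> convergent (\<lambda>n. (\<Sum>i<n. \<phi> ((f ^^ i) x)) / real n)}"


subsection \<open>Almost specification\<close>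

definition mistake_function :: "real \<Rightarrow> (nat \<Rightarrow> real \<Rightarrow> nat) \<Rightarrow> bool" where
  "mistake_function \<epsilon>0 g \<longleftrightarrow>
     \<epsilon>0 > 0 \<and>
     (\<forall>\<epsilon>\<in>{0<..\<epsilon>0}. (\<forall>n. g n \<epsilon> \<le> g (Suc n) \<epsilon>) \<and> (\<lambda>n. real (g n \<epsilon>) / real n) \<longlonglongrightarrow> 0)"

text \<open>The convention \<open>g(n, \<epsilon>) := g(n, \<epsilon>0)\<close> for \<open>\<epsilon> > \<epsilon>0\<close>.\<close>

definition extend_mistake :: "real \<Rightarrow> (nat \<Rightarrow> real \<Rightarrow> nat) \<Rightarrow> nat \<Rightarrow> real \<Rightarrow> nat" where
  "extend_mistake \<epsilon>0 g n \<epsilon> = (if \<epsilon> > \<epsilon>0 then g n \<epsilon>0 else g n \<epsilon>)"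

definition mistake_index_sets :: "(nat \<Rightarrow> real \<Rightarrow> nat) \<Rightarrow> nat \<Rightarrow> real \<Rightarrow> nat set set" where
  "mistake_index_sets g n \<epsilon> = {\<Lambda>. \<Lambda> \<subseteq> {..<n} \<and> card \<Lambda> \<ge> n - g n \<epsilon>}"

text \<open>
  The maximum is meaningful only for finite nonempty \<open>\<Lambda>\<close>; this is the case for all
  \<open>\<Lambda>\<close> in \<^const>\<open>mistake_index_sets\<close> as soon as \<open>g n \<epsilon> < n\<close>, which
  \<open>almost_specification\<close> below guarantees at every use.
\<close>

definition index_dist :: "('a::metric_space \<Rightarrow> 'a) \<Rightarrow> nat set \<Rightarrow> 'a \<Rightarrow> 'a \<Rightarrow> real" where
  "index_dist f \<Lambda> x y = Max ((\<lambda>j. dist ((f ^^ j) x) ((f ^^ j) y)) ` \<Lambda>)"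

definition index_ball :: "('a::metric_space \<Rightarrow> 'a) \<Rightarrow> nat set \<Rightarrow> 'a \<Rightarrow> real \<Rightarrow> 'a set" where
  "index_ball f \<Lambda> x \<epsilon> = {y. index_dist f \<Lambda> x y < \<epsilon>}"

definition mistake_ball ::
    "('a::metric_space \<Rightarrow> 'a) \<Rightarrow> (nat \<Rightarrow> real \<Rightarrow> nat) \<Rightarrow> nat \<Rightarrow> 'a \<Rightarrow> real \<Rightarrow> 'a set" where
  "mistake_ball f g n x \<epsilon> = (\<Union>\<Lambda>\<in>mistake_index_sets g n \<epsilon>. index_ball f \<Lambda> x \<epsilon>)"

text \<open>
  \<open>N\<close> is a function of \<open>\<epsilon>\<close> alone, chosen after \<open>g\<close>. With \<open>n\<^sub>0 = 0\<close> the exponent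
  \<open>n\<^sub>0 + \<dots> + n\<^bsub>j-1\<^esub>\<close> is the sum over \<open>{1..<j}\<close>.
\<close>

definition almost_specification :: "('a::metric_space \<Rightarrow> 'a) \<Rightarrow> bool" where
  "almost_specification f \<longleftrightarrow>
     (\<exists>\<epsilon>0 g. mistake_function \<epsilon>0 g \<and>
       (\<exists>N :: real \<Rightarrow> nat.
          (\<forall>\<epsilon>>0. \<forall>n\<ge>N \<epsilon>. extend_mistake \<epsilon>0 g n \<epsilon> < n) \<and>
          (\<forall>k\<ge>1. \<forall>(\<epsilon> :: nat \<Rightarrow> real) (x :: nat \<Rightarrow> 'a) (n :: nat \<Rightarrow> nat).
             (\<forall>j\<in>{1..k}. \<epsilon> j > 0 \<and> n j \<ge> N (\<epsilon> j)) \<longrightarrow>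
             (\<Inter>j\<in>{1..k}. (f ^^ (\<Sum>i\<in>{1..<j}. n i)) -`
                mistake_ball f (extend_mistake \<epsilon>0 g) (n j) (x j) (\<epsilon> j)) \<noteq> {})))"


subsection \<open>Bowen's entropy of a subset\<close>

definition bowen_ball :: "('a::metric_space \<Rightarrow> 'a) \<Rightarrow> nat \<Rightarrow> 'a \<Rightarrow> real \<Rightarrow> 'a set" where
  "bowen_ball f n x \<epsilon> = {y. \<forall>i<n. dist ((f ^^ i) x) ((f ^^ i) y) < \<epsilon>}"

text \<open>
  A collection of balls is given by the countable set of its parameters \<open>(n\<^sub>i, x\<^sub>i)\<close>;
  listing a pair repeatedly would only increase the sum.
\<close>

definition bowen_covers ::
    "('a::metric_space \<Rightarrow> 'a) \<Rightarrow> 'a set \<Rightarrow> real \<Rightarrow> nat \<Rightarrow> (nat \<times> 'a) set set" where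
  "bowen_covers f Z \<epsilon> N =
     {\<Gamma>. countable \<Gamma> \<and> (\<forall>(n, x)\<in>\<Gamma>. n \<ge> N) \<and> Z \<subseteq> (\<Union>(n, x)\<in>\<Gamma>. bowen_ball f n x \<epsilon>)}"

definition bowen_M ::
    "('a::metric_space \<Rightarrow> 'a) \<Rightarrow> 'a set \<Rightarrow> real \<Rightarrow> real \<Rightarrow> nat \<Rightarrow> ennreal" where
  "bowen_M f Z \<alpha> \<epsilon> N =
     (INF \<Gamma>\<in>bowen_covers f Z \<epsilon> N. \<Sum>\<^sub>\<infinity>(n, x)\<in>\<Gamma>. ennreal (exp (- \<alpha> * real n)))"

text \<open>
  Both limits below exist by monotonicity: \<^const>\<open>bowen_M\<close> is nondecreasing in \<open>N\<close>, and
  \<open>subset_entropy_at\<close> is nonincreasing in \<open>\<epsilon>\<close>. The infimum is over real \<open>\<alpha>\<close>, taken in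
  the extended reals.
\<close>

definition bowen_m :: "('a::metric_space \<Rightarrow> 'a) \<Rightarrow> 'a set \<Rightarrow> real \<Rightarrow> real \<Rightarrow> ennreal" where
  "bowen_m f Z \<alpha> \<epsilon> = lim (\<lambda>N. bowen_M f Z \<alpha> \<epsilon> N)"

definition subset_entropy_at :: "('a::metric_space \<Rightarrow> 'a) \<Rightarrow> 'a set \<Rightarrow> real \<Rightarrow> ereal" where
  "subset_entropy_at f Z \<epsilon> = Inf (ereal ` {\<alpha>. bowen_m f Z \<alpha> \<epsilon> = 0})"

definition subset_entropy :: "('a::metric_space \<Rightarrow> 'a) \<Rightarrow> 'a set \<Rightarrow> ereal" where
  "subset_entropy f Z = Lim (at_right 0) (\<lambda>\<epsilon>. subset_entropy_at f Z \<epsilon>)"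


subsection \<open>Topological entropy\<close>

text \<open>
  The Bowen--Dinaburg definition by \<open>(n, \<epsilon>)\<close>-separated sets. On a compact space and for
  continuous \<open>f\<close>, \<open>\<epsilon> > 0\<close>, the cardinalities of \<open>(n, \<epsilon>)\<close>-separated sets are bounded,
  so the maximum exists; it is nonincreasing in \<open>\<epsilon>\<close>, so the limit exists.
\<close>

definition separated_set :: "('a::metric_space \<Rightarrow> 'a) \<Rightarrow> nat \<Rightarrow> real \<Rightarrow> 'a set \<Rightarrow> bool" where
  "separated_set f n \<epsilon> E \<longleftrightarrow>
     (\<forall>x\<in>E. \<forall>y\<in>E. x \<noteq> y \<longrightarrow> (\<exists>i<n. dist ((f ^^ i) x) ((f ^^ i) y) > \<epsilon>))"

definition max_separated :: "('a::metric_space \<Rightarrow> 'a) \<Rightarrow> nat \<Rightarrow> real \<Rightarrow> nat" where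
  "max_separated f n \<epsilon> = Max (card ` {E. finite E \<and> separated_set f n \<epsilon> E})"

definition topological_entropy :: "('a::metric_space \<Rightarrow> 'a) \<Rightarrow> ereal" where
  "topological_entropy f =
     Lim (at_right 0) (\<lambda>\<epsilon>. limsup (\<lambda>n. ereal (ln (real (max_separated f n \<epsilon>)) / real n)))"

end

theory Submission
  imports Defs "HOL-Real_Asymp.Real_Asymp"
begin

text \<open>
  The proof is combinatorial and avoids the variational principle. Fix \<open>h\<close> below the topological
  entropy, a small scale and one large length \<open>n\<close>. By the pigeonhole principle exponentially many
  separated orbit segments of length \<open>n\<close> have nearly the same average of \<open>\<phi>\<close>, and since the integrals
  of \<open>\<phi>\<close> differ, some segment of length \<open>n\<close> has a definitely different average. Almost
  specification and compactness give orbits following any sequence of segments. Inserting the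
  exceptional segment at a set of positions of small but oscillating density makes these orbits
  irregular. The uniform product measure on the free segments shows that every cover by Bowen balls
  is expensive, because the mistakes cost only a subexponential factor.
\<close>

subsection \<open>Gluing and counting with mistakes\<close>

text \<open>The block length \<open>n\<close> never grows, so block averages are known only up to an
  error that does not tend to 0. The oscillation must beat this error, which dictates the order of
  choices: first \<open>q\<close>, which costs the factor 1 - 1/q in the entropy, then the
  tolerance, proportional to 1/q, then the scale, and \<open>n\<close> last, so large that mistakes
  and pigeonhole classes are absorbed in the gap between \<open>h\<close> and \<open>h'\<close>. The
  obstacle is that the positions of the mistakes are unknown and vary from orbit to orbit, so
  different words need not give separated orbits. Instead one counts how many of the separated
  segments a single point can shadow: the orbit of a word meets a given Bowen ball only if every
  free block inside the ball is one of the few segments shadowed by the centre. This constrains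
  words, not points; the measure therefore lives on the space of words, and an arbitrary choice of
  one orbit per word suffices. Passing to the centre doubles the scale and the counting doubles it
  again, so segments are separated at four times the gluing scale.\<close>

text \<open>Relaxed form of membership in \<open>mistake_ball\<close>: only distances strictly above
  \<epsilon> count as mistakes, which makes the condition closed in \<open>y\<close>, as the
  compactness argument requires.\<close>

definition almost_close :: "('a::metric_space \<Rightarrow> 'a) \<Rightarrow> nat \<Rightarrow> nat \<Rightarrow> real \<Rightarrow> 'a \<Rightarrow> 'a \<Rightarrow> bool" where
  "almost_close f n m \<epsilon> x y \<longleftrightarrow> card {i. i < n \<and> dist ((f ^^ i) x) ((f ^^ i) y) > \<epsilon>} \<le> m"

lemma continuous_on_funpow:
  fixes f :: "'a::topological_space \<Rightarrow> 'a"
  assumes "continuous_on UNIV f"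
  shows "continuous_on UNIV (f ^^ n)"
proof (induction n)
  case 0
  show ?case using continuous_on_id by (simp add: id_def)
next
  case (Suc n)
  show ?case
    using continuous_on_compose[OF Suc continuous_on_subset[OF assms]] by simp
qed

text \<open>Only finitely many mistake sets \<open>L\<close> are possible, and for each of them the
  condition on the remaining indices is an intersection of closed sets.\<close>

lemma closed_almost_close:
  assumes "continuous_on UNIV f"
  shows "closed {y. almost_close f n m \<epsilon> x y}"
proof -
  have eq: "{y. almost_close f n m \<epsilon> x y} =
    (\<Union>L\<in>{L. L \<subseteq> {..<n} \<and> card L \<le> m}. \<Inter>i\<in>{..<n} - L. {y. dist ((f ^^ i) x) ((f ^^ i) y) \<le> \<epsilon>})"
    (is "?A = ?B")
  proof (intro set_eqI iffI)
    fix y assume "y \<in> ?A"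
    then have "{i. i < n \<and> dist ((f ^^ i) x) ((f ^^ i) y) > \<epsilon>} \<in> {L. L \<subseteq> {..<n} \<and> card L \<le> m}"
      by (auto simp: almost_close_def)
    then show "y \<in> ?B"
      by (rule UN_I) (auto simp: not_less)
  next
    fix y assume "y \<in> ?B"
    then obtain L where L: "L \<subseteq> {..<n}" "card L \<le> m"
      "\<And>i. i \<in> {..<n} - L \<Longrightarrow> dist ((f ^^ i) x) ((f ^^ i) y) \<le> \<epsilon>"
      by auto
    have "{i. i < n \<and> dist ((f ^^ i) x) ((f ^^ i) y) > \<epsilon>} \<subseteq> L"
      using L(3) by force
    then have "card {i. i < n \<and> dist ((f ^^ i) x) ((f ^^ i) y) > \<epsilon>} \<le> card L"
      by (rule card_mono[OF finite_subset[OF L(1)], rotated]) simp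
    then show "y \<in> ?A"
      using L(2) by (simp add: almost_close_def)
  qed
  have "closed {y. dist ((f ^^ i) x) ((f ^^ i) y) \<le> \<epsilon>}" for i
    by (intro closed_Collect_le continuous_on_dist continuous_on_const continuous_on_funpow assms)
  then show ?thesis
    unfolding eq by (intro closed_UN closed_INT ballI finite_subset[of "{L. L \<subseteq> {..<n} \<and> card L \<le> m}" "Pow {..<n}"]) auto
qed

lemma mistake_ball_almost_close:
  assumes "g n \<epsilon> < n" and "y \<in> mistake_ball f g n x \<epsilon>"
  shows "almost_close f n (g n \<epsilon>) \<epsilon> x y"
proof -
  obtain L where L: "L \<subseteq> {..<n}" "card L \<ge> n - g n \<epsilon>" "index_dist f L x y < \<epsilon>"
    using assms(2) by (auto simp: mistake_ball_def mistake_index_sets_def index_ball_def)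
  have fin: "finite L"
    using L(1) finite_subset by blast
  \<comment> \<open>\<open>Max\<close> of the empty set is unspecified, so \<open>index_dist\<close>
    controls the single distances only for nonempty \<open>L\<close>; this is where
    \<open>g n \<epsilon> < n\<close> enters.\<close>
  have "L \<noteq> {}"
    using L(2) assms(1) by auto
  then have "dist ((f ^^ i) x) ((f ^^ i) y) < \<epsilon>" if "i \<in> L" for i
    using L(3) fin that by (auto simp: index_dist_def)
  then have "{i. i < n \<and> dist ((f ^^ i) x) ((f ^^ i) y) > \<epsilon>} \<subseteq> {..<n} - L"
    by force
  then have "card {i. i < n \<and> dist ((f ^^ i) x) ((f ^^ i) y) > \<epsilon>} \<le> card ({..<n} - L)"
    by (intro card_mono) auto
  also have "\<dots> = n - card L"
    using L(1) fin by (simp add: card_Diff_subset)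
  finally show ?thesis
    using L(2) unfolding almost_close_def by linarith
qed

lemma extend_mistake_tendsto:
  assumes "mistake_function \<epsilon>0 g" and "\<epsilon> > 0"
  shows "(\<lambda>n. real (extend_mistake \<epsilon>0 g n \<epsilon>) / real n) \<longlonglongrightarrow> 0"
  using assms by (cases "\<epsilon> > \<epsilon>0") (auto simp: mistake_function_def extend_mistake_def)

text \<open>Specification glues finitely many blocks; the finite intersection property extends this
  to infinite words. One common length and scale places block \<open>j\<close> at time
  \<open>j * n\<close>.\<close>

lemma almost_specification_infinite:
  fixes f :: "'a::metric_space \<Rightarrow> 'a"
  assumes comp: "compact (UNIV :: 'a set)" and cont: "continuous_on UNIV f"
    and spec: "almost_specification f"
  obtains g :: "nat \<Rightarrow> real \<Rightarrow> nat" and N :: "real \<Rightarrow> nat"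
  where "\<And>\<epsilon>. \<epsilon> > 0 \<Longrightarrow> (\<lambda>n. real (g n \<epsilon>) / real n) \<longlonglongrightarrow> 0"
    and "\<And>\<epsilon> n w. \<epsilon> > 0 \<Longrightarrow> n \<ge> N \<epsilon> \<Longrightarrow>
           \<exists>y. \<forall>j. almost_close f n (g n \<epsilon>) \<epsilon> (w j) ((f ^^ (j * n)) y)"
proof -
  obtain \<epsilon>0 g0 N where g0: "mistake_function \<epsilon>0 g0"
    and lt: "\<forall>\<epsilon>>0. \<forall>n\<ge>N \<epsilon>. extend_mistake \<epsilon>0 g0 n \<epsilon> < n"
    and glue: "\<forall>k\<ge>1. \<forall>(\<epsilon> :: nat \<Rightarrow> real) (x :: nat \<Rightarrow> 'a) (n :: nat \<Rightarrow> nat).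
             (\<forall>j\<in>{1..k}. \<epsilon> j > 0 \<and> n j \<ge> N (\<epsilon> j)) \<longrightarrow>
             (\<Inter>j\<in>{1..k}. (f ^^ (\<Sum>i\<in>{1..<j}. n i)) -`
                mistake_ball f (extend_mistake \<epsilon>0 g0) (n j) (x j) (\<epsilon> j)) \<noteq> {}"
    using spec unfolding almost_specification_def by (elim exE conjE) rule
  define g where "g = extend_mistake \<epsilon>0 g0"
  have ex: "\<exists>y. \<forall>j. almost_close f n (g n \<epsilon>) \<epsilon> (w j) ((f ^^ (j * n)) y)"
    if \<epsilon>: "\<epsilon> > 0" and n: "n \<ge> N \<epsilon>" for \<epsilon> n w
  proof -
    define F where "F j = {y. almost_close f n (g n \<epsilon>) \<epsilon> (w j) ((f ^^ (j * n)) y)}" for j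
    have "UNIV \<inter> (\<Inter>j\<in>UNIV. F j) \<noteq> {}"
    proof (rule compact_imp_fip_image[OF comp])
      fix j
      have "F j = (f ^^ (j * n)) -` {y. almost_close f n (g n \<epsilon>) \<epsilon> (w j) y}"
        by (auto simp: F_def)
      then show "closed (F j)"
        using closed_vimage[OF closed_almost_close[OF cont] continuous_on_funpow[OF cont]] by simp
    next
      fix I' :: "nat set" assume "finite I'"
      then obtain k where k: "I' \<subseteq> {..<k}"
        using finite_nat_iff_bounded by blast
      \<comment> \<open>Blocks are numbered from 0 here but from 1 in the specification property,
        whence \<open>w (j - 1)\<close>; \<open>Suc k\<close> guarantees at least one block.\<close>
      have "(\<Inter>j\<in>{1..Suc k}. (f ^^ (\<Sum>i\<in>{1..<j}. n)) -` mistake_ball f g n (w (j - 1)) \<epsilon>) \<noteq> {}"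
        using glue[rule_format, of "Suc k" "\<lambda>_. \<epsilon>" "\<lambda>_. n" "\<lambda>j. w (j - 1)"] \<epsilon> n
        unfolding g_def by simp
      then have "\<exists>y. \<forall>j\<in>{1..Suc k}. (f ^^ (\<Sum>i\<in>{1..<j}. n)) y \<in> mistake_ball f g n (w (j - 1)) \<epsilon>"
        by (simp only: ex_in_conv[symmetric] INT_iff vimage_eq)
      then obtain y where y:
        "\<And>j. j \<in> {1..Suc k} \<Longrightarrow> (f ^^ (\<Sum>i\<in>{1..<j}. n)) y \<in> mistake_ball f g n (w (j - 1)) \<epsilon>"
        by blast
      have "y \<in> F j" if "j < k" for j
        using y[of "Suc j"] that mistake_ball_almost_close[of g n \<epsilon> _ f "w j"] lt[rule_format, OF \<epsilon> n]
        by (simp add: F_def g_def)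
      then have "y \<in> UNIV \<inter> (\<Inter>j\<in>I'. F j)"
        using k by blast
      then show "UNIV \<inter> (\<Inter>j\<in>I'. F j) \<noteq> {}"
        by blast
    qed
    then show ?thesis
      by (auto simp: F_def)
  qed
  show thesis
    using that[of g N] extend_mistake_tendsto[OF g0] ex unfolding g_def by blast
qed

text \<open>Total boundedness at radius \<delta>/2, each point being sent to the centre of a ball
  containing it. The centres form the finite alphabet in which orbits are recorded at mistake
  indices.\<close>

lemma compact_finite_cells:
  fixes \<delta> :: real
  assumes "compact (UNIV :: 'a::metric_space set)" and "\<delta> > 0"
  obtains c :: "'a::metric_space \<Rightarrow> 'a" where "finite (range c)" and "\<And>x y. c x = c y \<Longrightarrow> dist x y \<le> \<delta>"
proof -
  obtain k :: "'a set" where k: "finite k" "UNIV \<subseteq> (\<Union>x\<in>k. ball x (\<delta> / 2))"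
    using seq_compact_imp_totally_bounded[OF compact_imp_seq_compact[OF assms(1)]] assms(2)
    by (meson half_gt_zero)
  have "\<exists>z. z \<in> k \<and> x \<in> ball z (\<delta> / 2)" for x
    using k(2) UNIV_I by fastforce
  then obtain c where c: "\<And>x. c x \<in> k" "\<And>x. x \<in> ball (c x) (\<delta> / 2)"
    by metis
  have "dist x y \<le> \<delta>" if "c x = c y" for x y
    using c(2)[of x] c(2)[of y] that dist_triangle3[of x y "c x"] by simp
  then show thesis
    by (intro that[of c] finite_subset[OF _ k(1)]) (use c(1) in auto)
qed

text \<open>Weight each \<open>L\<close> by \<open>x ^ card L\<close>: a set of at most
  \<open>m\<close> elements weighs at least \<open>x ^ m\<close>, and all subsets together weigh
  \<open>(1 + x) ^ n\<close>. With \<open>x\<close> small and then \<open>m / n\<close> small, the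
  exponential rate of the count is as small as desired.\<close>

lemma card_small_subsets_le:
  fixes x :: real
  assumes "0 < x" "x \<le> 1"
  shows "real (card {L. L \<subseteq> {..<n} \<and> card L \<le> m}) * x ^ m \<le> (1 + x) ^ n"
proof -
  have "real (card {L. L \<subseteq> {..<n} \<and> card L \<le> m}) * x ^ m =
      (\<Sum>L\<in>{L. L \<subseteq> {..<n} \<and> card L \<le> m}. x ^ m)"
    by simp
  also have "\<dots> \<le> (\<Sum>L\<in>{L. L \<subseteq> {..<n} \<and> card L \<le> m}. x ^ card L)"
    by (intro sum_mono power_decreasing) (use assms in auto)
  also have "\<dots> \<le> (\<Sum>L\<in>Pow {..<n}. x ^ card L)"
    by (intro sum_mono2) (use assms in auto)
  also have "\<dots> = (\<Prod>i<n. x + 1)"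
    using prod_add[of "{..<n}" "\<lambda>_. x" "\<lambda>_. 1"] by simp
  finally show ?thesis
    by (simp add: add.commute)
qed

text \<open>Mistakes are cheap: on the mistake indices an orbit is recorded only up to its cell, and
  outside of them two members are both close to \<^term>\<open>z\<close>.\<close>

lemma card_separated_almost_close_le:
  fixes f :: "'a::metric_space \<Rightarrow> 'a" and c :: "'a \<Rightarrow> 'b"
  assumes fin: "finite E" and sep: "separated_set f n (2 * \<delta>) E"
    and cells: "finite (range c)" "\<And>x y. c x = c y \<Longrightarrow> dist x y \<le> 2 * \<delta>"
    and x: "0 < x" "x \<le> 1"
  shows "real (card {u \<in> E. almost_close f n m \<delta> u z}) \<le>
    (1 + x) ^ n * (real (card (range c)) / x) ^ m"
proof -
  define F where "F = {u \<in> E. almost_close f n m \<delta> u z}"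
  define \<L> where "\<L> = {L. L \<subseteq> {..<n} \<and> card L \<le> m}"
  define K where "K = card (range c)"
  define L where "L u = {i. i < n \<and> dist ((f ^^ i) u) ((f ^^ i) z) > \<delta>}" for u
  define \<Phi> where "\<Phi> u = (L u, restrict (\<lambda>i. c ((f ^^ i) u)) (L u))" for u
  have K: "K \<ge> 1"
    using cells(1) by (simp add: K_def Suc_le_eq card_gt_0_iff)
  have fin\<L>: "finite \<L>"
    unfolding \<L>_def by (rule finite_subset[of _ "Pow {..<n}"]) auto
  have finL: "finite L" if "L \<in> \<L>" for L
    using that finite_subset[of L "{..<n}"] by (simp add: \<L>_def)
  have finPi: "finite (L \<rightarrow>\<^sub>E range c)" if "L \<in> \<L>" for L
    by (rule finite_PiE[OF finL[OF that] cells(1)])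
  have "inj_on \<Phi> F"
  proof (rule inj_onI, rule ccontr)
    fix u v assume uv: "u \<in> F" "v \<in> F" "\<Phi> u = \<Phi> v" "u \<noteq> v"
    then obtain i where i: "i < n" "dist ((f ^^ i) u) ((f ^^ i) v) > 2 * \<delta>"
      using sep by (auto simp: separated_set_def F_def)
    have Luv: "L u = L v"
      using uv(3) by (simp add: \<Phi>_def)
    have i': "i \<in> L u"
    proof (rule ccontr)
      assume "i \<notin> L u"
      then have "i \<notin> L u" "i \<notin> L v"
        using Luv by simp_all
      then have "dist ((f ^^ i) u) ((f ^^ i) z) \<le> \<delta>" "dist ((f ^^ i) v) ((f ^^ i) z) \<le> \<delta>"
        using i(1) unfolding L_def by simp_all
      then show False
        using i(2) dist_triangle2[of "(f ^^ i) u" "(f ^^ i) v" "(f ^^ i) z"] by simp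
    qed
    have "snd (\<Phi> u) i = snd (\<Phi> v) i"
      using uv(3) by simp
    then have "c ((f ^^ i) u) = c ((f ^^ i) v)"
      using i' Luv by (simp add: \<Phi>_def)
    then show False
      using cells(2) i(2) by fastforce
  qed
  moreover have "\<Phi> ` F \<subseteq> Sigma \<L> (\<lambda>L. L \<rightarrow>\<^sub>E range c)"
  proof (rule image_subsetI)
    fix u assume "u \<in> F"
    then have "L u \<in> \<L>"
      unfolding F_def \<L>_def L_def almost_close_def by blast
    then show "\<Phi> u \<in> Sigma \<L> (\<lambda>L. L \<rightarrow>\<^sub>E range c)"
      unfolding \<Phi>_def by (intro SigmaI) auto
  qed
  moreover have "finite (Sigma \<L> (\<lambda>L. L \<rightarrow>\<^sub>E range c))"
    by (rule finite_SigmaI[OF fin\<L> finPi])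
  ultimately have "card F \<le> card (Sigma \<L> (\<lambda>L. L \<rightarrow>\<^sub>E range c))"
    by (rule card_inj_on_le)
  also have "\<dots> = (\<Sum>L\<in>\<L>. card (L \<rightarrow>\<^sub>E range c))"
    by (rule card_SigmaI[OF fin\<L>]) (use finPi in blast)
  also have "\<dots> = (\<Sum>L\<in>\<L>. K ^ card L)"
    by (intro sum.cong) (auto simp: K_def card_PiE finL)
  also have "\<dots> \<le> (\<Sum>L\<in>\<L>. K ^ m)"
    by (intro sum_mono power_increasing K) (auto simp: \<L>_def)
  finally have "card F \<le> card \<L> * K ^ m"
    by simp
  then have "real (card F) \<le> real (card \<L>) * real K ^ m"
    by (metis of_nat_le_iff of_nat_mult of_nat_power)
  \<comment> \<open>Inserting \<open>x ^ m\<close> produces the weighted count of mistake sets; each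
    mistake then costs a factor \<open>K / x\<close>.\<close>
  also have "\<dots> = (real (card \<L>) * x ^ m) * (real K / x) ^ m"
    using x by (simp add: power_divide)
  also have "\<dots> \<le> (1 + x) ^ n * (real K / x) ^ m"
    using card_small_subsets_le[OF x] x by (intro mult_right_mono) (auto simp: \<L>_def)
  finally show ?thesis
    by (simp add: F_def K_def)
qed

subsection \<open>Product measure, oscillating averages, limits\<close>

lemma emeasure_UN_countable_le_infsum:
  assumes "countable I" and "\<And>i. i \<in> I \<Longrightarrow> U i \<in> sets M"
  shows "emeasure M (\<Union>i\<in>I. U i) \<le> (\<Sum>\<^sub>\<infinity>i\<in>I. emeasure M (U i))"
proof -
  define e where "e = to_nat_on I"
  define V where "V k = (if k \<in> e ` I then U (from_nat_into I k) else {})" for k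
  have e: "inj_on e I"
    unfolding e_def by (rule inj_on_to_nat_on[OF assms(1)])
  have inv_e: "from_nat_into I (e i) = i" if "i \<in> I" for i
    unfolding e_def by (rule from_nat_into_to_nat_on[OF assms(1) that])
  have VI: "V (e i) = U i" if "i \<in> I" for i
    using that inv_e[OF that] by (simp add: V_def)
  have "V k \<in> sets M" for k
    using VI assms(2) by (cases "k \<in> e ` I") (auto simp: V_def[of k] inv_e)
  then have "emeasure M (\<Union>k. V k) \<le> (\<Sum>k. emeasure M (V k))"
    by (intro emeasure_subadditive_countably) auto
  also have "(\<Union>k. V k) = (\<Union>i\<in>I. U i)"
  proof (intro equalityI subsetI)
    fix x assume "x \<in> (\<Union>k. V k)"
    then show "x \<in> (\<Union>i\<in>I. U i)"
      by (auto simp: V_def inv_e split: if_splits)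
  next
    fix x assume "x \<in> (\<Union>i\<in>I. U i)"
    then show "x \<in> (\<Union>k. V k)"
      using VI by blast
  qed
  also have "(\<Sum>k. emeasure M (V k)) \<le> (\<Sum>\<^sub>\<infinity>i\<in>I. emeasure M (U i))"
  proof (rule suminf_le_const)
    show "summable (\<lambda>k. emeasure M (V k))"
      by simp
    fix n
    define F where "F = {i \<in> I. e i < n}"
    have "inj_on e F"
      using e by (rule inj_on_subset) (simp add: F_def)
    moreover have "e ` F \<subseteq> {..<n}"
      by (auto simp: F_def)
    ultimately have "finite F"
      using finite_imageD finite_subset by blast
    have "(\<Sum>k<n. emeasure M (V k)) = (\<Sum>k\<in>e ` F. emeasure M (V k))"
      by (rule sum.mono_neutral_right) (auto simp: F_def V_def)
    also have "\<dots> = (\<Sum>i\<in>F. emeasure M (V (e i)))"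
      using sum.reindex[OF \<open>inj_on e F\<close>] by simp
    also have "\<dots> = (\<Sum>i\<in>F. emeasure M (U i))"
      by (intro sum.cong) (auto simp: F_def VI)
    also have "\<dots> = (\<Sum>\<^sub>\<infinity>i\<in>F. emeasure M (U i))"
      using \<open>finite F\<close> by simp
    also have "\<dots> \<le> (\<Sum>\<^sub>\<infinity>i\<in>I. emeasure M (U i))"
      by (rule infsum_mono_neutral) (auto simp: F_def intro: nonneg_summable_on_complete)
    finally show "(\<Sum>k<n. emeasure M (V k)) \<le> (\<Sum>\<^sub>\<infinity>i\<in>I. emeasure M (U i))" .
  qed
  finally show ?thesis .
qed

text \<open>A mass distribution principle on the space of words over \<open>S\<close>: under the
  product of uniform measures the cylinder of \<open>i\<close> has measure at most
  \<open>M / card S\<close> to the power \<open>card (J i)\<close>, and cylinders covering all words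
  have total measure at least 1.\<close>

lemma one_le_infsum_cylinder_cover:
  fixes S :: "'a set" and \<Gamma> :: "'i set" and A :: "'i \<Rightarrow> nat \<Rightarrow> 'a set"
  assumes S: "finite S" "S \<noteq> {}" and \<Gamma>: "countable \<Gamma>"
    and J: "\<And>i. i \<in> \<Gamma> \<Longrightarrow> finite (J i)"
    and A: "\<And>i j. i \<in> \<Gamma> \<Longrightarrow> j \<in> J i \<Longrightarrow> real (card (S \<inter> A i j)) \<le> M"
    and cover: "\<And>w. (\<And>j. w j \<in> S) \<Longrightarrow> \<exists>i\<in>\<Gamma>. \<forall>j\<in>J i. w j \<in> A i j"
  shows "1 \<le> (\<Sum>\<^sub>\<infinity>i\<in>\<Gamma>. ennreal ((M / real (card S)) ^ card (J i)))"
proof -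
  define \<mu> where "\<mu> = (\<lambda>_ :: nat. uniform_count_measure S)"
  interpret product_prob_space \<mu> UNIV
    unfolding \<mu>_def product_prob_space_def product_prob_space_axioms_def product_sigma_finite_def
    using prob_space_uniform_count_measure[OF S] prob_space_imp_sigma_finite by blast
  define U where "U i = {w \<in> space (PiM UNIV \<mu>). \<forall>j\<in>J i. w j \<in> S \<inter> A i j}" for i
  have sets: "S \<inter> A i j \<in> sets (\<mu> j)" for i j
    by (simp add: \<mu>_def sets_uniform_count_measure)
  have U: "U i \<in> sets (PiM UNIV \<mu>)" if "i \<in> \<Gamma>" for i
  proof -
    have "U i = prod_emb UNIV \<mu> (J i) (PiE (J i) (\<lambda>j. S \<inter> A i j))"
      by (auto simp: U_def prod_emb_def space_PiM)
    then show ?thesis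
      using sets_PiM_I[of "J i" UNIV "\<lambda>j. S \<inter> A i j" \<mu>] J[OF that] sets by simp
  qed
  have space: "w \<in> space (PiM UNIV \<mu>) \<longleftrightarrow> (\<forall>j. w j \<in> S)" for w
    by (auto simp: space_PiM \<mu>_def space_uniform_count_measure)
  have "1 = emeasure (PiM UNIV \<mu>) (space (PiM UNIV \<mu>))"
    by (simp add: P.emeasure_space_1)
  also have "space (PiM UNIV \<mu>) = (\<Union>i\<in>\<Gamma>. U i)"
    using cover by (fastforce simp: U_def space)
  also have "emeasure (PiM UNIV \<mu>) \<dots> \<le> (\<Sum>\<^sub>\<infinity>i\<in>\<Gamma>. emeasure (PiM UNIV \<mu>) (U i))"
    by (rule emeasure_UN_countable_le_infsum[OF \<Gamma> U])
  also have "\<dots> \<le> (\<Sum>\<^sub>\<infinity>i\<in>\<Gamma>. ennreal ((M / real (card S)) ^ card (J i)))"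
  proof (rule infsum_mono)
    fix i assume i: "i \<in> \<Gamma>"
    have "emeasure (PiM UNIV \<mu>) (U i) = (\<Prod>j\<in>J i. emeasure (\<mu> j) (S \<inter> A i j))"
      unfolding U_def by (rule emeasure_PiM_Collect) (use J[OF i] sets in auto)
    also have "\<dots> = (\<Prod>j\<in>J i. ennreal (real (card (S \<inter> A i j)) / real (card S)))"
      using S(1) by (intro prod.cong) (auto simp: \<mu>_def emeasure_uniform_count_measure)
    also have "\<dots> = ennreal (\<Prod>j\<in>J i. real (card (S \<inter> A i j)) / real (card S))"
      by (rule prod_ennreal) simp
    also have "\<dots> \<le> ennreal (\<Prod>j\<in>J i. M / real (card S))"
      by (intro ennreal_leI prod_mono) (use A[OF i] in \<open>auto intro!: divide_right_mono\<close>)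
    finally show "emeasure (PiM UNIV \<mu>) (U i) \<le> ennreal ((M / real (card S)) ^ card (J i))"
      by simp
  qed (simp_all add: nonneg_summable_on_complete)
  finally show ?thesis .
qed

text \<open>The intervals from m! to (m+1)! with m odd form a set of lower density 0 and upper
  density 1, because the ratio of consecutive factorials is unbounded. Dilation by \<open>q\<close>
  brings the upper density down to 1/q and bounds the count below every \<open>J\<close>, not just
  asymptotically, as is needed for Bowen balls of arbitrary length.\<close>

lemma oscillating_density_set:
  fixes q :: nat
  assumes "q > 0"
  obtains P :: "nat set" and k l :: "nat \<Rightarrow> nat"
  where "\<forall>J. card (P \<inter> {..<J}) \<le> J div q + 1"
    and "filterlim k at_top sequentially" and "filterlim l at_top sequentially"
    and "(\<lambda>m. real (card (P \<inter> {..<k m})) / real (k m)) \<longlonglongrightarrow> 1 / real q"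
    and "(\<lambda>m. real (card (P \<inter> {..<l m})) / real (l m)) \<longlonglongrightarrow> 0"
proof -
  define T where "T = {i :: nat. \<exists>m. odd m \<and> fact m \<le> i \<and> i < fact (Suc m)}"
  define P where "P = (*) q ` T"
  have card_P: "card (P \<inter> {..<q * K}) = card (T \<inter> {..<K})" for K
  proof -
    have "P \<inter> {..<q * K} = (*) q ` (T \<inter> {..<K})"
      using assms by (auto simp: P_def)
    then show ?thesis
      using assms by (simp add: card_image inj_on_def)
  qed
  \<comment> \<open>By parity, the intervals of \<open>T\<close> that start below (2m+1)! end no
    later than (2m)!.\<close>
  have upper: "card (T \<inter> {..<fact (2 * m + 1)}) \<le> fact (2 * m)" for m
  proof -
    have "T \<inter> {..<fact (2 * m + 1)} \<subseteq> {..<fact (2 * m)}"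
    proof
      fix i assume "i \<in> T \<inter> {..<fact (2 * m + 1)}"
      then obtain p where p: "odd p" "fact p \<le> i" "i < fact (Suc p)" "i < fact (2 * m + 1)"
        by (auto simp: T_def)
      then have "(fact p :: nat) < fact (2 * m + 1)"
        by linarith
      then have "p < 2 * m + 1"
        using fact_mono_nat[of "2 * m + 1" p] by (meson not_less)
      then have "Suc p \<le> 2 * m"
        using p(1) by presburger
      then show "i \<in> {..<fact (2 * m)}"
        using p(3) fact_mono_nat[of "Suc p" "2 * m"] by simp
    qed
    then have "card (T \<inter> {..<fact (2 * m + 1)}) \<le> card {..<fact (2 * m) :: nat}"
      by (intro card_mono) auto
    then show ?thesis
      by simp
  qed
  \<comment> \<open>The whole interval from (2m+1)! to (2m+2)! lies in \<open>T\<close>, so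
    \<open>T\<close> misses at most a fraction 1/(2m+2) below (2m+2)!.\<close>
  have lower: "card (T \<inter> {..<fact (2 * m + 2)}) + fact (2 * m + 1) \<ge> fact (2 * m + 2)" for m
  proof -
    have "{fact (2 * m + 1)..<fact (2 * m + 2)} \<subseteq> T \<inter> {..<fact (2 * m + 2)}"
      by (auto simp: T_def intro!: exI[of _ "2 * m + 1"])
    then have "card {fact (2 * m + 1)..<fact (2 * m + 2) :: nat} \<le> card (T \<inter> {..<fact (2 * m + 2)})"
      by (intro card_mono) auto
    then show ?thesis
      by simp
  qed
  have trivial_upper: "card (T \<inter> {..<K}) \<le> K" for K
    using card_mono[of "{..<K}" "T \<inter> {..<K}"] by simp
  have fact_ge: "m \<le> q * fact (2 * m + 1)" "m \<le> q * fact (2 * m + 2)" for m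
  proof -
    have *: "m \<le> q * fact p" if "m \<le> p" for p
      using that fact_ge_self[of p] assms by (metis le_trans mult_le_mono1 nat_mult_1 Suc_leI One_nat_def)
    show "m \<le> q * fact (2 * m + 1)" "m \<le> q * fact (2 * m + 2)"
      by (rule *, simp)+
  qed
  have lim_seq: "filterlim (\<lambda>m. q * fact (2 * m + 1)) at_top sequentially"
    "filterlim (\<lambda>m. q * fact (2 * m + 2)) at_top sequentially"
    using fact_ge by (auto intro!: filterlim_at_top_mono[OF filterlim_ident] always_eventually)
  have frac: "real (fact (Suc p - 1)) / real (fact (Suc p)) = 1 / real (Suc p)" for p
  proof -
    have "real (fact (Suc p)) = real (Suc p) * real (fact p)"
      by (metis fact_Suc of_nat_id of_nat_mult)
    then show ?thesis
      by (simp del: fact_Suc of_nat_Suc)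
  qed
  have to0: "(\<lambda>m. 1 / real (Suc (2 * m)) / real q) \<longlonglongrightarrow> 0"
    "(\<lambda>m. (1 - 1 / real (Suc (2 * m + 1))) / real q) \<longlonglongrightarrow> 1 / real q"
    using assms by (real_asymp, real_asymp simp: inverse_eq_divide)
  show thesis
  proof (rule that[of P "\<lambda>m. q * fact (2 * m + 2)" "\<lambda>m. q * fact (2 * m + 1)"])
    show "\<forall>J. card (P \<inter> {..<J}) \<le> J div q + 1"
    proof
      fix J
      have "P \<inter> {..<J} \<subseteq> (*) q ` {..J div q}"
      proof
        fix j assume "j \<in> P \<inter> {..<J}"
        then obtain i where i: "j = q * i" "j < J"
          by (auto simp: P_def)
        then have "i \<le> J div q"
          using assms by (simp add: less_eq_div_iff_mult_less_eq mult.commute)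
        then show "j \<in> (*) q ` {..J div q}"
          unfolding i(1) by (intro imageI) simp
      qed
      then have "card (P \<inter> {..<J}) \<le> card ((*) q ` {..J div q})"
        by (intro card_mono) auto
      also have "\<dots> \<le> J div q + 1"
        using card_image_le[of "{..J div q}" "(*) q"] by simp
      finally show "card (P \<inter> {..<J}) \<le> J div q + 1" .
    qed
  next
    show "(\<lambda>m. real (card (P \<inter> {..<q * fact (2 * m + 2)})) / real (q * fact (2 * m + 2))) \<longlonglongrightarrow> 1 / real q"
    proof (rule tendsto_sandwich[OF _ _ to0(2) tendsto_const]; intro always_eventually allI)
      fix m
      let ?K = "real (fact (2 * m + 2))"
      have "1 - 1 / real (Suc (2 * m + 1)) = (?K - real (fact (2 * m + 1))) / ?K"
        using frac[of "2 * m + 1"] by (simp add: diff_divide_distrib del: fact_Suc)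
      also have "\<dots> \<le> real (card (T \<inter> {..<fact (2 * m + 2)})) / ?K"
        using lower[of m] by (intro divide_right_mono) linarith+
      finally have le: "1 - 1 / real (Suc (2 * m + 1)) \<le> real (card (T \<inter> {..<fact (2 * m + 2)})) / ?K" .
      show "(1 - 1 / real (Suc (2 * m + 1))) / real q
          \<le> real (card (P \<inter> {..<q * fact (2 * m + 2)})) / real (q * fact (2 * m + 2))"
        unfolding card_P using divide_right_mono[OF le, of "real q"] by (simp add: mult.commute del: fact_Suc)
      show "real (card (P \<inter> {..<q * fact (2 * m + 2)})) / real (q * fact (2 * m + 2)) \<le> 1 / real q"
        unfolding card_P using of_nat_mono[OF trivial_upper[of "fact (2 * m + 2)"], where 'a = real] assms
        by (simp add: divide_simps del: fact_Suc)
    qed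
  next
    show "(\<lambda>m. real (card (P \<inter> {..<q * fact (2 * m + 1)})) / real (q * fact (2 * m + 1))) \<longlonglongrightarrow> 0"
    proof (rule tendsto_sandwich[OF _ _ tendsto_const to0(1)]; intro always_eventually allI)
      fix m
      have "real (card (T \<inter> {..<fact (2 * m + 1)})) / real (fact (2 * m + 1))
          \<le> real (fact (2 * m)) / real (fact (2 * m + 1))"
        using upper[of m] by (intro divide_right_mono) linarith+
      also have "\<dots> = 1 / real (Suc (2 * m))"
        using frac[of "2 * m"] by simp
      finally have le: "real (card (T \<inter> {..<fact (2 * m + 1)})) / real (fact (2 * m + 1)) \<le> 1 / real (Suc (2 * m))" .
      show "real (card (P \<inter> {..<q * fact (2 * m + 1)})) / real (q * fact (2 * m + 1))
          \<le> 1 / real (Suc (2 * m)) / real q"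
        unfolding card_P using divide_right_mono[OF le, of "real q"] by (simp add: mult.commute del: fact_Suc)
    qed simp
  qed (use lim_seq in auto)
qed

text \<open>The averages follow c + density * (c' - c) up to \<theta>. A limit would be within
  \<theta> of the values for both densities \<open>u\<close> and \<open>v\<close>, so these values
  would differ by at most 2\<theta>.\<close>

lemma averages_not_convergent:
  fixes b :: "nat \<Rightarrow> real"
  assumes b: "\<And>j. \<bar>b j - (if j \<in> P then c' else c)\<bar> \<le> \<theta>"
    and k: "filterlim k at_top sequentially"
      "(\<lambda>m. real (card (P \<inter> {..<k m})) / real (k m)) \<longlonglongrightarrow> u"
    and l: "filterlim l at_top sequentially"
      "(\<lambda>m. real (card (P \<inter> {..<l m})) / real (l m)) \<longlonglongrightarrow> v"
    and gap: "2 * \<theta> < \<bar>u - v\<bar> * \<bar>c' - c\<bar>"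
  shows "\<not> convergent (\<lambda>n. (\<Sum>j<n. b j) / real n)"
proof
  assume "convergent (\<lambda>n. (\<Sum>j<n. b j) / real n)"
  then obtain L where L: "(\<lambda>n. (\<Sum>j<n. b j) / real n) \<longlonglongrightarrow> L"
    by (auto simp: convergent_def)
  have close: "\<bar>(\<Sum>j<n. b j) / real n - (c + real (card (P \<inter> {..<n})) / real n * (c' - c))\<bar> \<le> \<theta>"
    if "n > 0" for n
  proof -
    have "(\<Sum>j<n. if j \<in> P then c' else c) = (\<Sum>j<n. c + (if j \<in> P then c' - c else 0))"
      by (intro sum.cong) auto
    also have "\<dots> = real n * c + real (card (P \<inter> {..<n})) * (c' - c)"
      by (simp add: sum.distrib sum.If_cases Int_commute)
    finally have "(\<Sum>j<n. b j) - (real n * c + real (card (P \<inter> {..<n})) * (c' - c)) =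
        (\<Sum>j<n. b j - (if j \<in> P then c' else c))"
      by (simp add: sum_subtractf)
    also have "\<bar>\<dots>\<bar> \<le> (\<Sum>j<n. \<theta>)"
      by (rule order_trans[OF sum_abs sum_mono]) (rule b)
    finally have "\<bar>(\<Sum>j<n. b j) - (real n * c + real (card (P \<inter> {..<n})) * (c' - c))\<bar> / real n \<le> \<theta>"
      using that by (simp add: field_simps)
    also have "\<bar>(\<Sum>j<n. b j) - (real n * c + real (card (P \<inter> {..<n})) * (c' - c))\<bar> / real n =
        \<bar>((\<Sum>j<n. b j) - (real n * c + real (card (P \<inter> {..<n})) * (c' - c))) / real n\<bar>"
      by simp
    also have "((\<Sum>j<n. b j) - (real n * c + real (card (P \<inter> {..<n})) * (c' - c))) / real n =
        (\<Sum>j<n. b j) / real n - (c + real (card (P \<inter> {..<n})) / real n * (c' - c))"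
      using that by (simp add: diff_divide_distrib add_divide_distrib)
    finally show ?thesis .
  qed
  have lim: "\<bar>L - (c + u * (c' - c))\<bar> \<le> \<theta>"
    if "filterlim k at_top sequentially" "(\<lambda>m. real (card (P \<inter> {..<k m})) / real (k m)) \<longlonglongrightarrow> u"
    for k u
  proof (rule tendsto_upperbound)
    show "(\<lambda>m. \<bar>(\<Sum>j<k m. b j) / real (k m) - (c + real (card (P \<inter> {..<k m})) / real (k m) * (c' - c))\<bar>)
      \<longlonglongrightarrow> \<bar>L - (c + u * (c' - c))\<bar>"
      using filterlim_compose[OF L that(1)] that(2) by (intro tendsto_intros)
    have "eventually (\<lambda>m. k m > 0) sequentially"
      by (rule eventually_compose_filterlim[OF eventually_gt_at_top that(1)])
    then show "eventually (\<lambda>m. \<bar>(\<Sum>j<k m. b j) / real (k m) -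
        (c + real (card (P \<inter> {..<k m})) / real (k m) * (c' - c))\<bar> \<le> \<theta>) sequentially"
      by eventually_elim (rule close)
  qed simp
  have "\<bar>u - v\<bar> * \<bar>c' - c\<bar> = \<bar>(L - (c + v * (c' - c))) - (L - (c + u * (c' - c)))\<bar>"
    by (simp add: abs_mult[symmetric] algebra_simps)
  also have "\<dots> \<le> 2 * \<theta>"
    using lim[OF k] lim[OF l] by linarith
  finally show False
    using gap by simp
qed

text \<open>By invariance the Birkhoff sum has integral \<open>n\<close> times that of \<phi>, so it
  cannot lie strictly below this number everywhere. This takes the place of an ergodic theorem and
  works for every \<open>n\<close>.\<close>

lemma exists_Birkhoff_sum_ge:
  fixes f :: "'a::metric_space \<Rightarrow> 'a" and \<phi> :: "'a \<Rightarrow> real"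
  assumes comp: "compact (UNIV :: 'a set)" and f: "continuous_on UNIV f"
    and \<phi>: "continuous_on UNIV \<phi>" and \<mu>: "\<mu> \<in> invariant_measures f" and "n > 0"
  shows "\<exists>v. (\<integral>x. \<phi> x \<partial>\<mu>) * real n \<le> (\<Sum>i<n. \<phi> ((f ^^ i) v))"
proof (rule ccontr)
  assume "\<not> ?thesis"
  then have less: "(\<Sum>i<n. \<phi> ((f ^^ i) v)) < (\<integral>x. \<phi> x \<partial>\<mu>) * real n" for v
    by (simp add: not_le)
  interpret prob_space \<mu>
    using \<mu> by (simp add: invariant_measures_def)
  have sets[measurable_cong]: "sets \<mu> = sets borel"
    using \<mu> by (simp add: invariant_measures_def)
  have f_meas: "f \<in> borel_measurable borel"
    by (rule borel_measurable_continuous_onI[OF f])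
  have [measurable]: "f \<in> measurable \<mu> borel" "\<phi> \<in> borel_measurable borel" "f \<in> measurable \<mu> \<mu>"
    using f_meas borel_measurable_continuous_onI[OF \<phi>] measurable_cong_sets[OF sets sets]
      measurable_cong_sets[OF sets refl] by auto
  have distr: "distr \<mu> \<mu> f = \<mu>"
  proof (rule measure_eqI)
    fix A assume "A \<in> sets (distr \<mu> \<mu> f)"
    then have A: "A \<in> sets borel"
      using sets by simp
    have "space \<mu> = UNIV"
      using sets_eq_imp_space_eq[OF sets] by simp
    then show "emeasure (distr \<mu> \<mu> f) A = emeasure \<mu> A"
      using A \<mu> sets by (simp add: emeasure_distr invariant_measures_def)
  qed simp
  obtain B where B: "\<And>x. \<bar>\<phi> x\<bar> \<le> B"
    using compact_imp_bounded[OF compact_continuous_image[OF \<phi> comp]]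
    by (auto simp: bounded_iff)
  have fi: "(f ^^ i) \<in> measurable \<mu> \<mu>" for i
    using borel_measurable_continuous_onI[OF continuous_on_funpow[OF f]]
      measurable_cong_sets[OF sets sets] by auto
  have int: "integrable \<mu> (\<lambda>x. \<phi> ((f ^^ i) x))" for i
    using B measurable_compose[OF fi, of \<phi> borel i] by (intro integrable_const_bound[where B = B]) auto
  have eq: "(\<integral>x. \<phi> ((f ^^ i) x) \<partial>\<mu>) = (\<integral>x. \<phi> x \<partial>\<mu>)" for i
  proof (induction i)
    case (Suc i)
    have "(\<integral>x. \<phi> ((f ^^ Suc i) x) \<partial>\<mu>) = (\<integral>x. \<phi> ((f ^^ i) (f x)) \<partial>\<mu>)"
      by (simp add: funpow_swap1)
    also have "\<dots> = (\<integral>x. \<phi> ((f ^^ i) x) \<partial>distr \<mu> \<mu> f)"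
      using measurable_compose[OF fi, of \<phi> borel i] by (intro integral_distr[symmetric]) auto
    finally show ?case
      using Suc distr by simp
  qed simp
  have "expectation (\<lambda>x. \<Sum>i<n. \<phi> ((f ^^ i) x)) < (\<integral>x. \<phi> x \<partial>\<mu>) * real n"
    using int less by (intro expectation_less) auto
  then show False
    using int eq by simp
qed

lemma tendsto_at_right_antimono_SUP:
  fixes F :: "real \<Rightarrow> ereal"
  assumes "\<And>x y. 0 < x \<Longrightarrow> x \<le> y \<Longrightarrow> F y \<le> F x"
  shows "(F \<longlongrightarrow> (SUP x\<in>{0<..}. F x)) (at_right 0)"
proof (rule order_tendstoI)
  fix a assume "a < (SUP x\<in>{0<..}. F x)"
  then obtain x where x: "x > 0" "a < F x"
    by (auto simp: less_SUP_iff)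
  then show "eventually (\<lambda>y. a < F y) (at_right 0)"
    unfolding eventually_at_right_field using assms by (intro exI[of _ x]) (auto intro: less_le_trans)
next
  fix a assume "(SUP x\<in>{0<..}. F x) < a"
  then have "F y < a" if "y > 0" for y
    using that SUP_upper[of y "{0<..}" F] by (auto intro: le_less_trans)
  then show "eventually (\<lambda>y. F y < a) (at_right 0)"
    unfolding eventually_at_right_field by (intro exI[of _ 1]) auto
qed

text \<open>Turns the limits over scales in both entropies into suprema, so that a lower bound can
  be proved at a single scale.\<close>

lemma Lim_at_right_antimono:
  fixes F :: "real \<Rightarrow> ereal"
  assumes "\<And>x y. 0 < x \<Longrightarrow> x \<le> y \<Longrightarrow> F y \<le> F x"
  shows "Lim (at_right 0) F = (SUP x\<in>{0<..}. F x)"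
  by (rule tendsto_Lim[OF _ tendsto_at_right_antimono_SUP[OF assms]]) simp_all

subsection \<open>Entropies as suprema over scales\<close>

lemma exists_max_separated:
  fixes f :: "'a::metric_space \<Rightarrow> 'a"
  assumes comp: "compact (UNIV :: 'a set)" and "\<epsilon> > 0"
  obtains E where "finite E" "separated_set f n \<epsilon> E" "card E = max_separated f n \<epsilon>"
    and "\<And>E'. finite E' \<Longrightarrow> separated_set f n \<epsilon> E' \<Longrightarrow> card E' \<le> max_separated f n \<epsilon>"
proof -
  obtain c :: "'a \<Rightarrow> 'a" where c: "finite (range c)" "\<And>x y. c x = c y \<Longrightarrow> dist x y \<le> \<epsilon>"
    using compact_finite_cells[OF comp \<open>\<epsilon> > 0\<close>] by blast
  define K where "K = card (range c)"
  have bound: "card E \<le> 2 ^ n * K ^ n" if "finite E" "separated_set f n \<epsilon> E" for E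
  proof -
    \<comment> \<open>With \<open>n\<close> mistakes allowed any two points are almost close, so the
      counting lemma with \<open>x = 1\<close> bounds all separated sets. Hence \<open>Max\<close>
      in \<open>max_separated\<close> is taken over a finite set.\<close>
    have "almost_close f n n (\<epsilon> / 2) u z" for u z
      using card_mono[of "{..<n}" "{i. i < n \<and> dist ((f ^^ i) u) ((f ^^ i) z) > \<epsilon> / 2}"]
      by (auto simp: almost_close_def)
    then have "real (card E) \<le> (1 + 1) ^ n * (real K / 1) ^ n"
      using card_separated_almost_close_le[of E f n "\<epsilon> / 2" c 1 n undefined] that c
      by (simp add: K_def)
    then have "real (card E) \<le> real (2 ^ n * K ^ n)"
      by simp
    then show ?thesis
      by (simp only: of_nat_le_iff)
  qed
  let ?C = "card ` {E. finite E \<and> separated_set f n \<epsilon> E}"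
  have fin: "finite ?C"
    using bound by (intro finite_subset[of ?C "{..2 ^ n * K ^ n}"]) auto
  have "{} \<in> {E. finite E \<and> separated_set f n \<epsilon> E}"
    by (simp add: separated_set_def)
  then have "?C \<noteq> {}"
    by blast
  then have "max_separated f n \<epsilon> \<in> ?C"
    unfolding max_separated_def by (rule Max_in[OF fin])
  then obtain E where E: "finite E" "separated_set f n \<epsilon> E" "card E = max_separated f n \<epsilon>"
    by auto
  have "card E' \<le> max_separated f n \<epsilon>" if "finite E'" "separated_set f n \<epsilon> E'" for E'
    unfolding max_separated_def using that by (intro Max_ge[OF fin]) auto
  then show thesis
    using that E by blast
qed

lemma max_separated_ge_1:
  fixes f :: "'a::metric_space \<Rightarrow> 'a"
  assumes "compact (UNIV :: 'a set)" and "\<epsilon> > 0"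
  shows "max_separated f n \<epsilon> \<ge> 1"
proof -
  obtain E where "\<And>E'. finite E' \<Longrightarrow> separated_set f n \<epsilon> E' \<Longrightarrow> card E' \<le> max_separated f n \<epsilon>"
    using exists_max_separated[OF assms, where f = f and n = n] by metis
  from this[of "{undefined}"] show ?thesis
    by (simp add: separated_set_def)
qed

lemma max_separated_antimono:
  fixes f :: "'a::metric_space \<Rightarrow> 'a"
  assumes comp: "compact (UNIV :: 'a set)" and "0 < \<epsilon>" "\<epsilon> \<le> \<epsilon>'"
  shows "max_separated f n \<epsilon>' \<le> max_separated f n \<epsilon>"
proof -
  have "0 < \<epsilon>'"
    using assms by simp
  obtain E where E: "finite E" "separated_set f n \<epsilon>' E" "card E = max_separated f n \<epsilon>'"
    using exists_max_separated[OF comp \<open>0 < \<epsilon>'\<close>, where f = f and n = n] by metis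
  have "separated_set f n \<epsilon> E"
    using E(2) assms(3) unfolding separated_set_def by (meson le_less_trans)
  then show ?thesis
    using exists_max_separated[OF comp \<open>0 < \<epsilon>\<close>, where f = f and n = n] E by metis
qed

text \<open>A separated set of maximal cardinality spans, since a point far from all its members
  could be adjoined. As separation is strict, spanning is non-strict.\<close>

lemma exists_spanning_set:
  fixes f :: "'a::metric_space \<Rightarrow> 'a"
  assumes comp: "compact (UNIV :: 'a set)" and "\<epsilon> > 0"
  obtains E where "finite E" "card E = max_separated f n \<epsilon>"
    and "\<And>y. \<exists>x\<in>E. \<forall>i<n. dist ((f ^^ i) x) ((f ^^ i) y) \<le> \<epsilon>"
proof -
  obtain E where E: "finite E" "separated_set f n \<epsilon> E" "card E = max_separated f n \<epsilon>"
    and max: "\<And>E'. finite E' \<Longrightarrow> separated_set f n \<epsilon> E' \<Longrightarrow> card E' \<le> max_separated f n \<epsilon>"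
    using exists_max_separated[OF assms, where f = f and n = n] by metis
  have "\<exists>x\<in>E. \<forall>i<n. dist ((f ^^ i) x) ((f ^^ i) y) \<le> \<epsilon>" for y
  proof (cases "y \<in> E")
    case True
    then show ?thesis
      using \<open>\<epsilon> > 0\<close> by (intro bexI[of _ y]) auto
  next
    case False
    show ?thesis
    proof (rule ccontr)
      assume "\<not> ?thesis"
      then have far: "\<exists>i<n. dist ((f ^^ i) x) ((f ^^ i) y) > \<epsilon>" if "x \<in> E" for x
        using that by (meson not_le)
      have "separated_set f n \<epsilon> (insert y E)"
        using E(2) far unfolding separated_set_def by (auto simp: dist_commute)
      then show False
        using max[of "insert y E"] E(1,3) False by simp
    qed
  qed
  then show thesis
    using that E by blast
qed

lemma topological_entropy_eq_SUP:
  fixes f :: "'a::metric_space \<Rightarrow> 'a"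
  assumes "compact (UNIV :: 'a set)"
  shows "topological_entropy f =
    (SUP \<epsilon>\<in>{0<..}. limsup (\<lambda>n. ereal (ln (real (max_separated f n \<epsilon>)) / real n)))"
  unfolding topological_entropy_def
proof (rule Lim_at_right_antimono, rule Limsup_mono, rule always_eventually, rule allI)
  fix x y :: real and n
  assume xy: "0 < x" "x \<le> y"
  have "1 \<le> max_separated f n y"
    using xy by (intro max_separated_ge_1[OF assms]) simp
  then have "ln (real (max_separated f n y)) \<le> ln (real (max_separated f n x))"
    using max_separated_antimono[OF assms xy, of f n] by simp
  then show "ereal (ln (real (max_separated f n y)) / real n) \<le> ereal (ln (real (max_separated f n x)) / real n)"
    by (simp add: divide_right_mono)
qed

lemma bowen_m_eq_SUP: "bowen_m f Z \<alpha> \<epsilon> = (SUP N. bowen_M f Z \<alpha> \<epsilon> N)"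
proof -
  have "incseq (bowen_M f Z \<alpha> \<epsilon>)"
    unfolding incseq_Suc_iff bowen_M_def
    by (intro allI INF_superset_mono) (auto simp: bowen_covers_def)
  then show ?thesis
    unfolding bowen_m_def by (intro limI LIMSEQ_SUP)
qed

lemma bowen_M_antimono_exponent:
  assumes "\<alpha> \<le> \<beta>"
  shows "bowen_M f Z \<beta> \<epsilon> N \<le> bowen_M f Z \<alpha> \<epsilon> N"
  unfolding bowen_M_def
proof (rule INF_mono)
  fix \<Gamma> assume "\<Gamma> \<in> bowen_covers f Z \<epsilon> N"
  moreover have "(\<Sum>\<^sub>\<infinity>(n, x)\<in>\<Gamma>. ennreal (exp (- \<beta> * real n))) \<le> (\<Sum>\<^sub>\<infinity>(n, x)\<in>\<Gamma>. ennreal (exp (- \<alpha> * real n)))"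
    using assms by (intro infsum_mono) (auto simp: nonneg_summable_on_complete intro!: ennreal_leI mult_right_mono)
  ultimately show "\<exists>\<Gamma>'\<in>bowen_covers f Z \<epsilon> N. (\<Sum>\<^sub>\<infinity>(n, x)\<in>\<Gamma>'. ennreal (exp (- \<beta> * real n)))
      \<le> (\<Sum>\<^sub>\<infinity>(n, x)\<in>\<Gamma>. ennreal (exp (- \<alpha> * real n)))"
    by blast
qed

lemma subset_entropy_eq_SUP:
  "subset_entropy f Z = (SUP \<epsilon>\<in>{0<..}. subset_entropy_at f Z \<epsilon>)"
  unfolding subset_entropy_def
proof (rule Lim_at_right_antimono)
  fix x y :: real assume "0 < x" "x \<le> y"
  then have "bowen_ball f n z x \<subseteq> bowen_ball f n z y" for n z
    by (auto simp: bowen_ball_def intro: less_le_trans)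
  then have "bowen_covers f Z x N \<subseteq> bowen_covers f Z y N" for N
    unfolding bowen_covers_def by (fastforce simp: subset_iff)
  then have "bowen_m f Z \<alpha> y \<le> bowen_m f Z \<alpha> x" for \<alpha>
    unfolding bowen_m_eq_SUP bowen_M_def by (intro SUP_mono' INF_superset_mono) auto
  then have "{\<alpha>. bowen_m f Z \<alpha> x = 0} \<subseteq> {\<alpha>. bowen_m f Z \<alpha> y = 0}"
    by (metis (mono_tags, lifting) le_zero_eq mem_Collect_eq subsetI)
  then show "subset_entropy_at f Z y \<le> subset_entropy_at f Z x"
    unfolding subset_entropy_at_def by (intro Inf_superset_mono image_mono)
qed

text \<open>\<open>bowen_M\<close> decreases in the exponent, so a \<beta> below \<alpha> inherits
  the positive lower bound and cannot make \<open>bowen_m\<close> vanish.\<close>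

lemma subset_entropy_at_ge:
  assumes "C > 0" and "\<And>N. C \<le> bowen_M f Z \<alpha> \<epsilon> N"
  shows "ereal \<alpha> \<le> subset_entropy_at f Z \<epsilon>"
  unfolding subset_entropy_at_def
proof (rule Inf_greatest, clarify)
  fix \<beta> assume \<beta>: "bowen_m f Z \<beta> \<epsilon> = 0"
  show "ereal \<alpha> \<le> ereal \<beta>"
  proof (rule ccontr)
    assume "\<not> ?thesis"
    then have "C \<le> bowen_M f Z \<beta> \<epsilon> 0"
      using assms(2)[of 0] bowen_M_antimono_exponent[of \<beta> \<alpha> f Z \<epsilon> 0] by simp
    also have "\<dots> \<le> bowen_m f Z \<beta> \<epsilon>"
      unfolding bowen_m_eq_SUP by (rule SUP_upper) simp
    finally show False
      using \<beta> \<open>C > 0\<close> by simp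
  qed
qed

text \<open>Cover the whole space by balls of one length \<open>n \<ge> N\<close> centred at a
  spanning set. For \<beta> strictly between the growth rate and \<alpha> this costs at most
  exp(-(\<alpha> - \<beta>) n), which tends to 0. The passage from \<epsilon> to a larger
  \<epsilon>' turns the non-strict spanning inequality into open balls.\<close>

lemma subset_entropy_at_le:
  fixes f :: "'a::metric_space \<Rightarrow> 'a"
  assumes comp: "compact (UNIV :: 'a set)" and \<epsilon>: "0 < \<epsilon>" "\<epsilon> < \<epsilon>'"
  shows "subset_entropy_at f Z \<epsilon>' \<le> limsup (\<lambda>n. ereal (ln (real (max_separated f n \<epsilon>)) / real n))"
    (is "_ \<le> ?h")
proof (rule dense_ge)
  fix z assume z: "?h < z"
  show "subset_entropy_at f Z \<epsilon>' \<le> z"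
  proof (cases z)
    case (real \<alpha>)
    obtain \<beta> where \<beta>: "?h < ereal \<beta>" "\<beta> < \<alpha>"
      using ereal_dense2[of ?h "ereal \<alpha>"] z real by auto
    have ev: "eventually (\<lambda>n. ln (real (max_separated f n \<epsilon>)) / real n < \<beta>) sequentially"
      using Limsup_lessD[OF \<beta>(1)] by simp
    have "bowen_M f Z \<alpha> \<epsilon>' N \<le> 0" for N
    proof (rule tendsto_lowerbound)
      have "(\<lambda>n. exp (- (\<alpha> - \<beta>) * real n)) \<longlonglongrightarrow> 0"
        using \<beta>(2) by real_asymp
      then have "(\<lambda>n. ennreal (exp (- (\<alpha> - \<beta>) * real n))) \<longlonglongrightarrow> ennreal 0"
        by (rule tendsto_ennrealI)
      then show "(\<lambda>n. ennreal (exp (- (\<alpha> - \<beta>) * real n))) \<longlonglongrightarrow> 0"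
        by simp
      show "eventually (\<lambda>n. bowen_M f Z \<alpha> \<epsilon>' N \<le> ennreal (exp (- (\<alpha> - \<beta>) * real n))) sequentially"
        using ev eventually_ge_at_top[of N] eventually_gt_at_top[of 0]
      proof eventually_elim
        case (elim n)
        obtain E where E: "finite E" "card E = max_separated f n \<epsilon>"
          and span: "\<And>y. \<exists>x\<in>E. \<forall>i<n. dist ((f ^^ i) x) ((f ^^ i) y) \<le> \<epsilon>"
          using exists_spanning_set[OF comp \<epsilon>(1), where f = f and n = n] by metis
        define \<Gamma> where "\<Gamma> = Pair n ` E"
        have "\<exists>x\<in>E. y \<in> bowen_ball f n x \<epsilon>'" for y
          using span[of y] \<epsilon>(2) unfolding bowen_ball_def by (auto intro: le_less_trans)
        then have "\<Gamma> \<in> bowen_covers f Z \<epsilon>' N"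
          using E(1) elim(2) by (auto simp: bowen_covers_def \<Gamma>_def countable_finite)
        then have "bowen_M f Z \<alpha> \<epsilon>' N \<le> (\<Sum>\<^sub>\<infinity>(n, x)\<in>\<Gamma>. ennreal (exp (- \<alpha> * real n)))"
          unfolding bowen_M_def by (rule INF_lower)
        also have "\<dots> = (\<Sum>(n, x)\<in>\<Gamma>. ennreal (exp (- \<alpha> * real n)))"
          using E(1) by (simp add: \<Gamma>_def)
        also have "\<dots> = (\<Sum>x\<in>E. ennreal (exp (- \<alpha> * real n)))"
          unfolding \<Gamma>_def by (subst sum.reindex) (auto simp: inj_on_def)
        also have "\<dots> = ennreal (real (card E) * exp (- \<alpha> * real n))"
          by (simp add: ennreal_mult' ennreal_of_nat_eq_real_of_nat)
        also have "\<dots> \<le> ennreal (exp (- (\<alpha> - \<beta>) * real n))"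
        proof (rule ennreal_leI)
          have "card E \<ge> 1"
            using E(2) max_separated_ge_1[OF comp \<epsilon>(1)] by simp
          then have "real (card E) = exp (ln (real (card E)))"
            by simp
          also have "\<dots> \<le> exp (\<beta> * real n)"
            using elim(1,3) E(2) by (simp add: field_simps)
          finally have "real (card E) * exp (- \<alpha> * real n) \<le> exp (\<beta> * real n) * exp (- \<alpha> * real n)"
            by (rule mult_right_mono) simp
          then show "real (card E) * exp (- \<alpha> * real n) \<le> exp (- (\<alpha> - \<beta>) * real n)"
            by (simp add: exp_add[symmetric] algebra_simps)
        qed
        finally show ?case .
      qed
    qed simp
    then have "bowen_m f Z \<alpha> \<epsilon>' = 0"
      by (simp add: bowen_m_eq_SUP)
    then show ?thesis
      unfolding subset_entropy_at_def real by (intro Inf_lower) simp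
  qed (use z in auto)
qed

lemma subset_entropy_le_topological_entropy:
  fixes f :: "'a::metric_space \<Rightarrow> 'a"
  assumes "compact (UNIV :: 'a set)"
  shows "subset_entropy f Z \<le> topological_entropy f"
  unfolding subset_entropy_eq_SUP topological_entropy_eq_SUP[OF assms]
  by (rule SUP_mono) (metis assms field_lbound_gt_zero greaterThan_iff subset_entropy_at_le dense)

subsection \<open>Lower bound for the irregular set\<close>

lemma infsum_cmult_ennreal:
  fixes c :: ennreal
  shows "(\<Sum>\<^sub>\<infinity>i\<in>A. c * f i) = c * (\<Sum>\<^sub>\<infinity>i\<in>A. f i)"
  by (simp add: nonneg_infsum_complete SUP_mult_left_ennreal sum_distrib_left)

text \<open>A mistake changes a summand by at most 2B, any other index by at most \<rho>.\<close>

lemma Birkhoff_sum_almost_close: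
  fixes \<phi> :: "'a::metric_space \<Rightarrow> real"
  assumes osc: "\<And>x y. dist x y \<le> \<epsilon> \<Longrightarrow> \<bar>\<phi> x - \<phi> y\<bar> \<le> \<rho>" and "\<rho> \<ge> 0"
    and B: "\<And>x. \<bar>\<phi> x\<bar> \<le> B" and close: "almost_close f n m \<epsilon> x y"
  shows "\<bar>(\<Sum>i<n. \<phi> ((f ^^ i) x)) - (\<Sum>i<n. \<phi> ((f ^^ i) y))\<bar> \<le> real n * \<rho> + real m * (2 * B)"
proof -
  define D where "D = {i. i < n \<and> dist ((f ^^ i) x) ((f ^^ i) y) > \<epsilon>}"
  have D: "{..<n} \<inter> D = D" "real (card D) \<le> real m"
    using close by (auto simp: D_def almost_close_def)
  have B0: "B \<ge> 0"
    using B[of x] by linarith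
  have "\<bar>(\<Sum>i<n. \<phi> ((f ^^ i) x)) - (\<Sum>i<n. \<phi> ((f ^^ i) y))\<bar>
      \<le> (\<Sum>i<n. \<bar>\<phi> ((f ^^ i) x) - \<phi> ((f ^^ i) y)\<bar>)"
    unfolding sum_subtractf[symmetric] by (rule sum_abs)
  also have "\<dots> \<le> (\<Sum>i<n. \<rho> + (if i \<in> D then 2 * B else 0))"
  proof (rule sum_mono)
    fix i assume i: "i \<in> {..<n}"
    show "\<bar>\<phi> ((f ^^ i) x) - \<phi> ((f ^^ i) y)\<bar> \<le> \<rho> + (if i \<in> D then 2 * B else 0)"
    proof (cases "i \<in> D")
      case True
      then show ?thesis
        using B[of "(f ^^ i) x"] B[of "(f ^^ i) y"] \<open>\<rho> \<ge> 0\<close> by simp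
    next
      case False
      then have "dist ((f ^^ i) x) ((f ^^ i) y) \<le> \<epsilon>"
        using i by (simp add: D_def)
      then show ?thesis
        using osc[of "(f ^^ i) x" "(f ^^ i) y"] False by simp
    qed
  qed
  also have "\<dots> = real n * \<rho> + real (card D) * (2 * B)"
    using D(1) by (simp add: sum.distrib sum.If_cases)
  also have "\<dots> \<le> real n * \<rho> + real m * (2 * B)"
    using D(2) B0 by (intro add_left_mono mult_right_mono) auto
  finally show ?thesis .
qed

lemma Birkhoff_sum_blocks:
  fixes \<phi> :: "'a \<Rightarrow> real"
  shows "(\<Sum>i<k * n. \<phi> ((f ^^ i) y)) = (\<Sum>j<k. \<Sum>i<n. \<phi> ((f ^^ i) ((f ^^ (j * n)) y)))"
proof -
  have "(\<Sum>i<n. \<phi> ((f ^^ i) ((f ^^ (j * n)) y))) = (\<Sum>i\<in>{j * n..<j * n + n}. \<phi> ((f ^^ i) y))" for j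
    using sum.shift_bounds_nat_ivl[of "\<lambda>i. \<phi> ((f ^^ i) y)" 0 "j * n" n]
    by (simp add: atLeast0LessThan add.commute funpow_add[symmetric] comp_apply[symmetric, of "f ^^ _"]
        del: comp_apply)
  then show ?thesis
    using sum.nat_group[of "\<lambda>i. \<phi> ((f ^^ i) y)" n k] by simp
qed

text \<open>The averages of block averages are the Birkhoff averages along multiples of
  \<open>n\<close>; divergence of this subsequence is enough.\<close>

lemma irregular_setI_blocks:
  fixes \<phi> :: "'a \<Rightarrow> real"
  assumes "n > 0"
    and "\<not> convergent (\<lambda>k. (\<Sum>j<k. (\<Sum>i<n. \<phi> ((f ^^ i) ((f ^^ (j * n)) y))) / real n) / real k)"
  shows "y \<in> irregular_set f \<phi>"
proof (rule ccontr)
  assume "y \<notin> irregular_set f \<phi>"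
  then obtain L where L: "(\<lambda>n. (\<Sum>i<n. \<phi> ((f ^^ i) y)) / real n) \<longlonglongrightarrow> L"
    by (auto simp: irregular_set_def convergent_def)
  have "strict_mono (\<lambda>k. k * n)"
    using assms(1) by (simp add: strict_mono_def)
  from LIMSEQ_subseq_LIMSEQ[OF L this]
  have "(\<lambda>k. (\<Sum>i<k * n. \<phi> ((f ^^ i) y)) / real (k * n)) \<longlonglongrightarrow> L"
    by (simp add: comp_def)
  also have "(\<lambda>k. (\<Sum>i<k * n. \<phi> ((f ^^ i) y)) / real (k * n)) =
      (\<lambda>k. (\<Sum>j<k. (\<Sum>i<n. \<phi> ((f ^^ i) ((f ^^ (j * n)) y))) / real n) / real k)"
    by (simp add: Birkhoff_sum_blocks sum_divide_distrib[symmetric] mult.commute)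
  finally show False
    using assms(2) by (auto simp: convergent_def)
qed

text \<open>Replaces the orbit \<open>y\<close>, which depends on the word, by the centre
  \<open>x\<close> of the ball. The resulting constraint on the block \<open>u\<close> depends on
  the ball alone, at the price of doubling the scale.\<close>

lemma almost_close_bowen_ball:
  assumes "almost_close f n m \<epsilon> u ((f ^^ k) y)" and "y \<in> bowen_ball f N x \<epsilon>" and "k + n \<le> N"
  shows "almost_close f n m (2 * \<epsilon>) u ((f ^^ k) x)"
proof -
  have "{i. i < n \<and> dist ((f ^^ i) u) ((f ^^ i) ((f ^^ k) x)) > 2 * \<epsilon>}
      \<subseteq> {i. i < n \<and> dist ((f ^^ i) u) ((f ^^ i) ((f ^^ k) y)) > \<epsilon>}"
  proof clarify
    fix i assume i: "i < n" "dist ((f ^^ i) u) ((f ^^ i) ((f ^^ k) x)) > 2 * \<epsilon>"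
    have "dist ((f ^^ (i + k)) x) ((f ^^ (i + k)) y) < \<epsilon>"
      using assms(2,3) i(1) by (simp add: bowen_ball_def)
    then have "dist ((f ^^ i) ((f ^^ k) x)) ((f ^^ i) ((f ^^ k) y)) < \<epsilon>"
      by (simp add: funpow_add)
    then show "dist ((f ^^ i) u) ((f ^^ i) ((f ^^ k) y)) > \<epsilon>"
      using i(2) dist_triangle2[of "(f ^^ i) u" "(f ^^ i) ((f ^^ k) x)" "(f ^^ i) ((f ^^ k) y)"] by linarith
  qed
  then have "card {i. i < n \<and> dist ((f ^^ i) u) ((f ^^ i) ((f ^^ k) x)) > 2 * \<epsilon>}
      \<le> card {i. i < n \<and> dist ((f ^^ i) u) ((f ^^ i) ((f ^^ k) y)) > \<epsilon>}"
    by (rule card_mono[rotated]) simp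
  then show ?thesis
    using assms(1) by (simp add: almost_close_def)
qed

text \<open>Of about N/n blocks at least the fraction 1 - 1/q is free, each contributing a factor
  exp(-n h). Rounding loses at most two blocks, one from \<open>N div n\<close> and one from the
  \<open>+ 1\<close>; hence the constant exp(2 n h).\<close>

lemma power_card_le_exp:
  fixes r h :: real
  assumes "0 \<le> r" "r \<le> exp (- (real n * h))" "h > 0" "n > 0" "q > 0"
    and J: "N div n \<le> J + (N div n div q + 1)"
  shows "r ^ J \<le> exp (2 * real n * h) * exp (- (h * (1 - 1 / real q)) * real N)"
proof -
  define t where "t = 1 - 1 / real q"
  have t: "0 \<le> t" "t \<le> 1"
    using assms(5) by (simp_all add: t_def field_simps)
  have "real (N div n div q) \<le> real (N div n) / real q"
    by (rule of_nat_div_le_of_nat)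
  then have "real J \<ge> real (N div n) * t - 1"
    using of_nat_mono[OF J, where 'a = real] by (simp add: t_def algebra_simps)
  moreover have "real N / real n - 1 \<le> real (N div n)"
    using floor_correct[of "real N / real n"] by (simp add: floor_divide_of_nat_eq)
  then have "(real N / real n - 1) * t \<le> real (N div n) * t"
    using t(1) by (rule mult_right_mono)
  then have "real N / real n * t - t \<le> real (N div n) * t"
    by (simp add: left_diff_distrib)
  ultimately have "real N / real n * t - 2 \<le> real J"
    using t(2) by linarith
  then have "(real n * h) * (real N / real n * t - 2) \<le> (real n * h) * real J"
    using assms(3) by (intro mult_left_mono) auto
  then have "real N * h * t - 2 * real n * h \<le> real n * h * real J"
    using assms(4) by (simp add: right_diff_distrib mult_ac)
  then have "- (real n * h) * real J \<le> 2 * real n * h + (- (h * t) * real N)"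
    by (simp add: mult_ac)
  then have "exp (- (real n * h) * real J) \<le> exp (2 * real n * h + (- (h * t) * real N))"
    by simp
  moreover have "r ^ J \<le> exp (- (real n * h)) ^ J"
    by (rule power_mono) (use assms in auto)
  then have "r ^ J \<le> exp (- (real n * h) * real J)"
    by (simp add: exp_of_nat_mult[symmetric] mult_ac)
  ultimately show ?thesis
    unfolding exp_add t_def by linarith
qed

text \<open>Orbits following a word in \<^term>\<open>S\<close>, with the filler \<^term>\<open>v\<close> inserted at the positions of a
  set of oscillating density at most \<^term>\<open>1 / q\<close>, are irregular. A Bowen ball of length \<open>N\<close> contains
  such orbits only for words in a cylinder, of measure about \<^term>\<open>exp (- (h * (1 - 1 / q)) * N)\<close>.\<close>

lemma irregular_set_block_construction:
  fixes f :: "'a::metric_space \<Rightarrow> 'a" and \<phi> :: "'a \<Rightarrow> real" and n m q :: nat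
  assumes n: "n > 0" and q: "q > 0"
    and S: "finite S" "S \<noteq> {}"
    and count: "\<And>z. real (card {u \<in> S. almost_close f n m (2 * \<epsilon>) u z}) \<le> M"
    and small: "M / real (card S) \<le> exp (- (real n * h))"
    and glue: "\<And>w. \<exists>y. \<forall>j. almost_close f n m \<epsilon> (w j) ((f ^^ (j * n)) y)"
    and osc: "\<And>x y. dist x y \<le> \<epsilon> \<Longrightarrow> \<bar>\<phi> x - \<phi> y\<bar> \<le> \<rho>" "\<rho> \<ge> 0"
    and B: "\<And>x. \<bar>\<phi> x\<bar> \<le> B"
    and \<theta>: "\<rho> + 2 * B * (real m / real n) \<le> \<theta>"
    and avg: "\<And>u. u \<in> S \<Longrightarrow> \<bar>(\<Sum>i<n. \<phi> ((f ^^ i) u)) / real n - c\<bar> \<le> \<theta>"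
    and gap: "4 * \<theta> < \<bar>(\<Sum>i<n. \<phi> ((f ^^ i) v)) / real n - c\<bar> / real q"
  shows "irregular_set f \<phi> \<noteq> {}"
    and "h > 0 \<Longrightarrow> ennreal (exp (- (2 * real n * h)))
           \<le> bowen_M f (irregular_set f \<phi>) (h * (1 - 1 / real q)) \<epsilon> N"
proof -
  define c' where "c' = (\<Sum>i<n. \<phi> ((f ^^ i) v)) / real n"
  obtain P k l where P: "\<forall>J. card (P \<inter> {..<J}) \<le> J div q + 1"
    and k: "filterlim k at_top sequentially"
      "(\<lambda>m. real (card (P \<inter> {..<k m})) / real (k m)) \<longlonglongrightarrow> 1 / real q"
    and l: "filterlim l at_top sequentially"
      "(\<lambda>m. real (card (P \<inter> {..<l m})) / real (l m)) \<longlonglongrightarrow> 0"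
    by (rule oscillating_density_set[OF q]) (rule that)
  have "\<exists>y. \<forall>j. almost_close f n m \<epsilon> (if j \<in> P then v else w j) ((f ^^ (j * n)) y)" for w
    using glue[of "\<lambda>j. if j \<in> P then v else w j"] .
  then obtain p where p: "\<And>w j. almost_close f n m \<epsilon> (if j \<in> P then v else w j) ((f ^^ (j * n)) (p w))"
    by metis
  have "B \<ge> 0"
    using B[of v] by linarith
  then have \<theta>0: "\<theta> \<ge> 0"
    using \<theta> osc(2) by (intro order_trans[OF _ \<theta>]) simp
  \<comment> \<open>A block average is within 2\<theta> of its target: \<theta> for the shadowing
    and \<theta> for the spread of averages in \<open>S\<close>. Comparing densities 1/q and 0
    doubles this once more, which explains the 4 in \<open>gap\<close>.\<close>
  have irr: "p w \<in> irregular_set f \<phi>" if w: "\<And>j. w j \<in> S" for w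
  proof (rule irregular_setI_blocks[OF n], rule averages_not_convergent[OF _ k l])
    fix j
    define a where "a x = (\<Sum>i<n. \<phi> ((f ^^ i) x)) / real n" for x
    let ?u = "if j \<in> P then v else w j" and ?y = "(f ^^ (j * n)) (p w)"
    have "\<bar>(\<Sum>i<n. \<phi> ((f ^^ i) ?u)) - (\<Sum>i<n. \<phi> ((f ^^ i) ?y))\<bar> \<le> real n * \<rho> + real m * (2 * B)"
      by (rule Birkhoff_sum_almost_close[OF osc B p])
    then have "\<bar>(\<Sum>i<n. \<phi> ((f ^^ i) ?u)) - (\<Sum>i<n. \<phi> ((f ^^ i) ?y))\<bar> / real n
        \<le> (real n * \<rho> + real m * (2 * B)) / real n"
      by (rule divide_right_mono) simp
    also have "\<dots> = \<rho> + 2 * B * (real m / real n)"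
      using n by (simp add: field_simps)
    finally have "\<bar>a ?u - a ?y\<bar> \<le> \<theta>"
      using \<theta> n by (simp add: a_def diff_divide_distrib[symmetric])
    moreover have "\<bar>a ?u - (if j \<in> P then c' else c)\<bar> \<le> \<theta>"
      using avg[OF w[of j]] \<theta>0 by (simp add: a_def c'_def)
    ultimately show "\<bar>(\<Sum>i<n. \<phi> ((f ^^ i) ((f ^^ (j * n)) (p w)))) / real n - (if j \<in> P then c' else c)\<bar> \<le> 2 * \<theta>"
      unfolding a_def[symmetric] by linarith
  next
    show "2 * (2 * \<theta>) < \<bar>1 / real q - 0\<bar> * \<bar>c' - c\<bar>"
      using gap q by (simp add: c'_def)
  qed
  obtain s where s: "s \<in> S"
    using S(2) by blast
  then show "irregular_set f \<phi> \<noteq> {}"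
    using irr[of "\<lambda>_. s"] by blast
  assume h: "h > 0"
  show "ennreal (exp (- (2 * real n * h))) \<le> bowen_M f (irregular_set f \<phi>) (h * (1 - 1 / real q)) \<epsilon> N"
    unfolding bowen_M_def
  proof (rule INF_greatest)
    fix \<Gamma> assume \<Gamma>: "\<Gamma> \<in> bowen_covers f (irregular_set f \<phi>) \<epsilon> N"
    \<comment> \<open>The free blocks lying entirely inside the ball \<open>i\<close>; only these
      restrict the word.\<close>
    define J where "J i = {..<fst i div n} - P" for i :: "nat \<times> 'a"
    define A where "A i j = {u. almost_close f n m (2 * \<epsilon>) u ((f ^^ (j * n)) (snd i))}" for i :: "nat \<times> 'a" and j
    have "1 \<le> (\<Sum>\<^sub>\<infinity>i\<in>\<Gamma>. ennreal ((M / real (card S)) ^ card (J i)))"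
    proof (rule one_le_infsum_cylinder_cover[OF S, where A = A])
      show "countable \<Gamma>"
        using \<Gamma> by (simp add: bowen_covers_def)
      show "finite (J i)" for i
        by (simp add: J_def)
      have "S \<inter> A i j = {u \<in> S. almost_close f n m (2 * \<epsilon>) u ((f ^^ (j * n)) (snd i))}" for i j
        by (auto simp: A_def)
      then show "real (card (S \<inter> A i j)) \<le> M" for i j
        using count by simp
      fix w :: "nat \<Rightarrow> 'a" assume "\<And>j. w j \<in> S"
      then have "p w \<in> irregular_set f \<phi>"
        by (rule irr)
      then obtain i where i: "i \<in> \<Gamma>" "p w \<in> bowen_ball f (fst i) (snd i) \<epsilon>"
        using \<Gamma> by (fastforce simp: bowen_covers_def)
      have "w j \<in> A i j" if "j \<in> J i" for j
      proof -
        have "Suc j \<le> fst i div n"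
          using that by (simp add: J_def)
        then have "Suc j * n \<le> fst i"
          by (meson div_times_less_eq_dividend le_trans mult_le_mono1)
        then have "almost_close f n m (2 * \<epsilon>) (w j) ((f ^^ (j * n)) (snd i))"
          using that p[of j w] by (intro almost_close_bowen_ball[OF _ i(2)]) (auto simp: J_def)
        then show ?thesis
          by (simp add: A_def)
      qed
      then show "\<exists>i\<in>\<Gamma>. \<forall>j\<in>J i. w j \<in> A i j"
        using i(1) by blast
    qed
    also have "\<dots> \<le> (\<Sum>\<^sub>\<infinity>i\<in>\<Gamma>. ennreal (exp (2 * real n * h)) *
        (case i of (k, x) \<Rightarrow> ennreal (exp (- (h * (1 - 1 / real q)) * real k))))"
    proof (rule infsum_mono)
      fix i assume "i \<in> \<Gamma>"
      have "M \<ge> 0"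
        using count[of v] of_nat_0_le_iff order_trans by blast
      have "{..<fst i div n} = J i \<union> (P \<inter> {..<fst i div n})"
        by (auto simp: J_def)
      then have "fst i div n \<le> card (J i) + card (P \<inter> {..<fst i div n})"
        using card_Un_le[of "J i" "P \<inter> {..<fst i div n}"] by (metis card_lessThan)
      then have J: "fst i div n \<le> card (J i) + (fst i div n div q + 1)"
        using P[rule_format, of "fst i div n"] by linarith
      have "(M / real (card S)) ^ card (J i) \<le> exp (2 * real n * h) * exp (- (h * (1 - 1 / real q)) * real (fst i))"
        by (rule power_card_le_exp[OF _ small h n q J]) (use \<open>M \<ge> 0\<close> in simp)
      then show "ennreal ((M / real (card S)) ^ card (J i)) \<le> ennreal (exp (2 * real n * h)) *
          (case i of (k, x) \<Rightarrow> ennreal (exp (- (h * (1 - 1 / real q)) * real k)))"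
        by (simp add: case_prod_beta ennreal_mult'[symmetric] ennreal_leI)
    qed (simp_all add: nonneg_summable_on_complete)
    also have "\<dots> = ennreal (exp (2 * real n * h)) *
        (\<Sum>\<^sub>\<infinity>(k, x)\<in>\<Gamma>. ennreal (exp (- (h * (1 - 1 / real q)) * real k)))"
      (is "_ = _ * ?X") by (rule infsum_cmult_ennreal)
    finally have "ennreal (exp (- (2 * real n * h))) * 1
        \<le> ennreal (exp (- (2 * real n * h))) * (ennreal (exp (2 * real n * h)) * ?X)"
      by (rule mult_left_mono) simp
    also have "\<dots> = ?X"
      by (simp add: mult.assoc[symmetric] ennreal_mult'[symmetric] exp_add[symmetric] del: exp_minus)
    finally show "ennreal (exp (- (2 * real n * h))) \<le> ?X"
      by simp
  qed
qed

text \<open>Pigeonhole on the integer part of a/\<eta>. The number of classes depends only on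
  \<open>B\<close> and \<eta>, so for averages over length \<open>n\<close> it is negligible on the
  exponential scale.\<close>

lemma exists_concentrated_subset:
  fixes a :: "'a \<Rightarrow> real"
  assumes "finite E" and "\<eta> > 0" and a: "\<And>u. \<bar>a u\<bar> \<le> B"
  obtains S c where "S \<subseteq> E" and "card E \<le> card S * card {\<lfloor>- B / \<eta>\<rfloor>..\<lfloor>B / \<eta>\<rfloor>}"
    and "\<And>u. u \<in> S \<Longrightarrow> \<bar>a u - c\<bar> \<le> \<eta>"
proof -
  let ?I = "{\<lfloor>- B / \<eta>\<rfloor>..\<lfloor>B / \<eta>\<rfloor>}"
  define cls where "cls u = \<lfloor>a u / \<eta>\<rfloor>" for u
  have cls: "cls u \<in> ?I" for u
  proof -
    have "- B \<le> a u" "a u \<le> B"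
      using a[of u] by linarith+
    then have "- B / \<eta> \<le> a u / \<eta>" "a u / \<eta> \<le> B / \<eta>"
      using \<open>\<eta> > 0\<close> by (intro divide_right_mono; simp)+
    then show ?thesis
      unfolding cls_def by (simp add: floor_mono del: minus_divide_left)
  qed
  then have ne: "?I \<noteq> {}"
    by blast
  obtain y where y: "card (cls -` {y} \<inter> E) * card ?I \<ge> card E"
    using pigeonhole_card[of cls E ?I] cls \<open>finite E\<close> ne by blast
  have "\<bar>a u - real_of_int y * \<eta>\<bar> \<le> \<eta>" if "u \<in> cls -` {y} \<inter> E" for u
  proof -
    have "real_of_int y \<le> a u / \<eta>" "a u / \<eta> < real_of_int y + 1"
      using that by (auto simp: cls_def floor_eq_iff)
    then have "real_of_int y * \<eta> \<le> a u" "a u < (real_of_int y + 1) * \<eta>"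
      using \<open>\<eta> > 0\<close> by (simp_all add: field_simps)
    then show ?thesis
      by (simp add: abs_le_iff algebra_simps)
  qed
  then show thesis
    using y by (intro that[of "cls -` {y} \<inter> E" "real_of_int y * \<eta>"]) auto
qed

lemma irregular_set_lower_bound:
  fixes f :: "'a::metric_space \<Rightarrow> 'a" and \<phi> :: "'a \<Rightarrow> real" and h h' :: real and q :: nat
  assumes comp: "compact (UNIV :: 'a set)" and cont: "continuous_on UNIV f"
    and spec: "almost_specification f" and \<phi>: "continuous_on UNIV \<phi>"
    and \<mu>: "\<mu>1 \<in> invariant_measures f" "\<mu>2 \<in> invariant_measures f"
      "(\<integral>x. \<phi> x \<partial>\<mu>1) < (\<integral>x. \<phi> x \<partial>\<mu>2)"
    and h': "ereal h' < topological_entropy f" and hh': "h < h'" and q: "q > 0"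
  shows "irregular_set f \<phi> \<noteq> {}"
    and "h > 0 \<Longrightarrow> \<exists>\<epsilon>>0. \<exists>C>0. \<forall>N. C \<le> bowen_M f (irregular_set f \<phi>) (h * (1 - 1 / real q)) \<epsilon> N"
proof -
  obtain g :: "nat \<Rightarrow> real \<Rightarrow> nat" and N
    where g: "\<And>\<epsilon>. \<epsilon> > 0 \<Longrightarrow> (\<lambda>n. real (g n \<epsilon>) / real n) \<longlonglongrightarrow> 0"
    and glue: "\<And>\<epsilon> n w. \<epsilon> > 0 \<Longrightarrow> n \<ge> N \<epsilon> \<Longrightarrow>
           \<exists>y. \<forall>j. almost_close f n (g n \<epsilon>) \<epsilon> (w j) ((f ^^ (j * n)) y)"
    using almost_specification_infinite[OF comp cont spec] by blast
  obtain B where B: "\<And>x. \<bar>\<phi> x\<bar> \<le> B"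
    using compact_imp_bounded[OF compact_continuous_image[OF \<phi> comp]]
    by (auto simp: bounded_iff)
  define G where "G = ((\<integral>x. \<phi> x \<partial>\<mu>2) - (\<integral>x. \<phi> x \<partial>\<mu>1)) / 2"
  have "G > 0"
    using \<mu>(3) by (simp add: G_def)
  \<comment> \<open>Chosen so that \<open>G / q = 8 * \<eta>\<close>, comfortably above the 4\<eta>
    that the oscillation must exceed. Half of \<eta> goes to the modulus of continuity of \<phi>,
    half to the mistakes.\<close>
  define \<eta> where "\<eta> = G / (8 * real q)"
  have "\<eta> > 0"
    using \<open>G > 0\<close> q by (simp add: \<eta>_def)
  obtain \<delta> where \<delta>: "\<delta> > 0" "\<And>x y. dist x y < \<delta> \<Longrightarrow> \<bar>\<phi> x - \<phi> y\<bar> < \<eta> / 2"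
    using compact_uniformly_continuous[OF \<phi> comp] \<open>\<eta> > 0\<close>
    unfolding uniformly_continuous_on_def dist_real_def
    by (metis UNIV_I half_gt_zero)
  define s where "s \<epsilon> = limsup (\<lambda>n. ereal (ln (real (max_separated f n \<epsilon>)) / real n))" for \<epsilon>
  obtain \<epsilon>1 where \<epsilon>1: "\<epsilon>1 > 0" "ereal h' < s \<epsilon>1"
    using h' unfolding topological_entropy_eq_SUP[OF comp] s_def by (auto simp: less_SUP_iff)
  \<comment> \<open>Gluing happens at \<epsilon>, comparison with a ball centre at 2\<epsilon>,
    separation at 4\<epsilon>, which must not exceed the scale \<epsilon>1 at which the entropy is
    seen.\<close>
  define \<epsilon> where "\<epsilon> = min (\<delta> / 2) (\<epsilon>1 / 4)"
  have \<epsilon>: "\<epsilon> > 0" "\<epsilon> < \<delta>" "2 * (2 * \<epsilon>) \<le> \<epsilon>1"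
    using \<delta>(1) \<epsilon>1(1) by (auto simp: \<epsilon>_def min_def)
  have osc: "\<bar>\<phi> x - \<phi> y\<bar> \<le> \<eta> / 2" if "dist x y \<le> \<epsilon>" for x y
    using \<delta>(2)[of x y] that \<epsilon>(2) by simp
  \<comment> \<open>The limsup provides good lengths only infinitely often. The other requirements
    on \<open>n\<close> hold eventually, so they can be met at the same time.\<close>
  have freq: "\<exists>\<^sub>F n in sequentially. h' < ln (real (max_separated f n (2 * (2 * \<epsilon>)))) / real n"
  proof (rule ccontr)
    assume "\<not> ?thesis"
    then have "eventually (\<lambda>n. ln (real (max_separated f n (2 * (2 * \<epsilon>)))) / real n \<le> h') sequentially"
      by (simp add: not_frequently not_less)
    moreover have "ln (real (max_separated f n \<epsilon>1)) / real n
        \<le> ln (real (max_separated f n (2 * (2 * \<epsilon>)))) / real n" for n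
      using max_separated_antimono[OF comp _ \<epsilon>(3), of f n] max_separated_ge_1[OF comp \<epsilon>1(1), of f n] \<epsilon>(1)
      by (intro divide_right_mono) simp_all
    ultimately have "eventually (\<lambda>n. ereal (ln (real (max_separated f n \<epsilon>1)) / real n) \<le> ereal h') sequentially"
      by (auto elim!: eventually_mono intro: order_trans)
    then have "s \<epsilon>1 \<le> ereal h'"
      unfolding s_def by (rule Limsup_bounded)
    then show False
      using \<epsilon>1(2) by simp
  qed
  have "2 * (2 * \<epsilon>) > 0"
    using \<epsilon>(1) by simp
  then obtain cell :: "'a \<Rightarrow> 'a" where cell: "finite (range cell)"
    "\<And>x y. cell x = cell y \<Longrightarrow> dist x y \<le> 2 * (2 * \<epsilon>)"
    using compact_finite_cells[OF comp] by blast
  define K where "K = real (card (range cell))"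
  have K: "K \<ge> 1"
    using cell(1) by (simp add: K_def Suc_le_eq card_gt_0_iff)
  define Kc where "Kc = card {\<lfloor>- B / \<eta>\<rfloor>..\<lfloor>B / \<eta>\<rfloor>}"
  define x where "x = min 1 ((h' - h) / 2)"
  have x: "0 < x" "x \<le> 1" "x < h' - h"
    using hh' by (auto simp: x_def min_def)
  have "(\<lambda>n. 2 * B * (real (g n \<epsilon>) / real n)) \<longlonglongrightarrow> 2 * B * 0"
    by (intro tendsto_intros g \<epsilon>(1))
  then have ev1: "eventually (\<lambda>n. 2 * B * (real (g n \<epsilon>) / real n) < \<eta> / 2) sequentially"
    by (rule order_tendstoD(2)) (use \<open>\<eta> > 0\<close> in simp)
  \<comment> \<open>Exponential rates to be paid from \<open>h' - h\<close>: \<open>x\<close> bounds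
    ln(1 + x) for the mistake sets, the second term covers the mistakes themselves, the third the
    pigeonhole classes.\<close>
  have "(\<lambda>n. x + real (g n \<epsilon>) / real n * ln (K / x) + ln (real Kc) / real n) \<longlonglongrightarrow> x + 0 * ln (K / x) + 0"
    by (intro tendsto_intros g \<epsilon>(1))
  then have ev2: "eventually (\<lambda>n. x + real (g n \<epsilon>) / real n * ln (K / x) + ln (real Kc) / real n < h' - h) sequentially"
    by (rule order_tendstoD(2)) (use x(3) in simp)
  have "\<exists>\<^sub>F n in sequentially. h' < ln (real (max_separated f n (2 * (2 * \<epsilon>)))) / real n \<and>
      2 * B * (real (g n \<epsilon>) / real n) < \<eta> / 2 \<and>
      x + real (g n \<epsilon>) / real n * ln (K / x) + ln (real Kc) / real n < h' - h \<and> n > 0 \<and> n \<ge> N \<epsilon>"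
    by (intro frequently_eventually_frequently[OF freq] eventually_conj ev1 ev2
        eventually_gt_at_top eventually_ge_at_top)
  then have "\<exists>n. h' < ln (real (max_separated f n (2 * (2 * \<epsilon>)))) / real n \<and>
      2 * B * (real (g n \<epsilon>) / real n) < \<eta> / 2 \<and>
      x + real (g n \<epsilon>) / real n * ln (K / x) + ln (real Kc) / real n < h' - h \<and> n > 0 \<and> n \<ge> N \<epsilon>"
    by (rule frequently_ex)
  then obtain n where n: "h' < ln (real (max_separated f n (2 * (2 * \<epsilon>)))) / real n"
      "2 * B * (real (g n \<epsilon>) / real n) < \<eta> / 2"
      "x + real (g n \<epsilon>) / real n * ln (K / x) + ln (real Kc) / real n < h' - h" "n > 0" "n \<ge> N \<epsilon>"
    by blast
  define m where "m = g n \<epsilon>"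
  obtain E where E: "finite E" "separated_set f n (2 * (2 * \<epsilon>)) E" "card E = max_separated f n (2 * (2 * \<epsilon>))"
    by (rule exists_max_separated[OF comp \<open>2 * (2 * \<epsilon>) > 0\<close>]) (rule that)
  define a where "a u = (\<Sum>i<n. \<phi> ((f ^^ i) u)) / real n" for u
  have "\<bar>a u\<bar> \<le> B" for u
  proof -
    have "\<bar>\<Sum>i<n. \<phi> ((f ^^ i) u)\<bar> \<le> (\<Sum>i<n. B)"
      by (rule order_trans[OF sum_abs sum_mono]) (rule B)
    then show ?thesis
      using n(4) by (simp add: a_def field_simps)
  qed
  then obtain S c where S: "S \<subseteq> E" "card E \<le> card S * Kc" "\<And>u. u \<in> S \<Longrightarrow> \<bar>a u - c\<bar> \<le> \<eta>"
    using exists_concentrated_subset[OF E(1) \<open>\<eta> > 0\<close>, of a B] unfolding Kc_def by blast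
  have "card E > 0"
    using max_separated_ge_1[OF comp \<open>2 * (2 * \<epsilon>) > 0\<close>, of f n] E(3) by simp
  then have pos: "card S > 0" "Kc > 0"
    using S(2) by (auto intro!: Nat.gr0I)
  define M where "M = (1 + x) ^ n * (K / x) ^ m"
  have count: "real (card {u \<in> S. almost_close f n m (2 * \<epsilon>) u z}) \<le> M" for z
    unfolding M_def K_def
  proof (rule card_separated_almost_close_le[OF _ _ cell x(1,2)])
    show "finite S"
      using S(1) E(1) finite_subset by blast
    show "separated_set f n (2 * (2 * \<epsilon>)) S"
      using S(1) E(2) unfolding separated_set_def by blast
  qed
  \<comment> \<open>\<open>E\<close> has at least exp(n h') members, \<open>S\<close> at least a
    fraction 1 / \<open>Kc\<close> of them, while the budget gives M * Kc at most exp(n (h' -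
    h)).\<close>
  have small: "M / real (card S) \<le> exp (- (real n * h))"
  proof -
    have "M > 0"
      using x K by (simp add: M_def)
    have "ln M = real n * ln (1 + x) + real m * ln (K / x)"
      using x K by (simp add: M_def ln_mult ln_realpow)
    also have "\<dots> \<le> real n * x + real m * ln (K / x)"
      using x(1) by (intro add_right_mono mult_left_mono ln_add_one_self_le_self) auto
    finally have "ln M + ln (real Kc) \<le> real n * (x + real m / real n * ln (K / x) + ln (real Kc) / real n)"
      using n(4) by (simp add: distrib_left)
    also have "\<dots> \<le> real n * (h' - h)"
      using n(3) by (intro mult_left_mono) (auto simp: m_def)
    finally have "ln (M * real Kc) \<le> real n * (h' - h)"
      using \<open>M > 0\<close> pos(2) by (simp add: ln_mult)
    moreover have "real n * h' \<le> ln (real (card E))"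
      using n(1,4) E(3) by (simp add: field_simps)
    moreover have "ln (real (card E)) \<le> ln (real (card S) * real Kc)"
      using S(2) \<open>card E > 0\<close> pos by (simp flip: of_nat_mult)
    ultimately have "ln M - ln (real (card S)) \<le> - (real n * h)"
      using \<open>M > 0\<close> pos by (simp add: ln_mult right_diff_distrib)
    then have "ln (M / real (card S)) \<le> - (real n * h)"
      using \<open>M > 0\<close> pos by (simp add: ln_div)
    then have "exp (ln (M / real (card S))) \<le> exp (- (real n * h))"
      by simp
    then show ?thesis
      using \<open>M > 0\<close> pos by simp
  qed
  \<comment> \<open>The pigeonhole value \<open>c\<close> is beyond control. Two segments whose
    averages differ by at least 2G, one from each measure, ensure that one of them is at distance at
    least \<open>G\<close> from \<open>c\<close>.\<close>
  have "\<exists>v. G \<le> \<bar>a v - c\<bar>"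
  proof -
    obtain v2 where v2: "(\<integral>x. \<phi> x \<partial>\<mu>2) * real n \<le> (\<Sum>i<n. \<phi> ((f ^^ i) v2))"
      using exists_Birkhoff_sum_ge[OF comp cont \<phi> \<mu>(2) n(4)] by blast
    obtain v1 where v1: "(\<integral>x. - \<phi> x \<partial>\<mu>1) * real n \<le> (\<Sum>i<n. - \<phi> ((f ^^ i) v1))"
      using exists_Birkhoff_sum_ge[OF comp cont continuous_on_minus[OF \<phi>] \<mu>(1) n(4)] by blast
    have "(\<integral>x. \<phi> x \<partial>\<mu>2) \<le> a v2" "a v1 \<le> (\<integral>x. \<phi> x \<partial>\<mu>1)"
      using v1 v2 n(4) by (simp_all add: a_def field_simps sum_negf)
    then have "a v2 - a v1 \<ge> 2 * G"
      by (simp add: G_def)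
    then have "G \<le> \<bar>a v2 - c\<bar> \<or> G \<le> \<bar>a v1 - c\<bar>"
      by linarith
    then show ?thesis
      by blast
  qed
  then obtain v where v: "G \<le> \<bar>a v - c\<bar>"
    by blast
  have gap: "4 * \<eta> < \<bar>(\<Sum>i<n. \<phi> ((f ^^ i) v)) / real n - c\<bar> / real q"
  proof -
    have "8 * \<eta> = G / real q"
      by (simp add: \<eta>_def)
    then have "4 * \<eta> < G / real q"
      using \<open>\<eta> > 0\<close> by linarith
    also have "\<dots> \<le> \<bar>a v - c\<bar> / real q"
      using v by (rule divide_right_mono) simp
    finally show ?thesis
      by (simp add: a_def)
  qed
  have "finite S" "S \<noteq> {}"
    using pos(1) by (simp_all add: card_gt_0_iff)
  have "\<eta> / 2 \<ge> 0" "\<eta> / 2 + 2 * B * (real m / real n) \<le> \<eta>"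
    using \<open>\<eta> > 0\<close> n(2) by (simp_all add: m_def)
  note construction = irregular_set_block_construction[OF n(4) q \<open>finite S\<close> \<open>S \<noteq> {}\<close> count small
      glue[OF \<epsilon>(1) n(5), folded m_def] osc this(1) B this(2) S(3)[unfolded a_def] gap]
  show "irregular_set f \<phi> \<noteq> {}"
    by (rule construction(1))
  assume "h > 0"
  show "\<exists>\<epsilon>>0. \<exists>C>0. \<forall>N. C \<le> bowen_M f (irregular_set f \<phi>) (h * (1 - 1 / real q)) \<epsilon> N"
  proof (intro exI[of _ \<epsilon>] conjI exI[of _ "ennreal (exp (- (2 * real n * h)))"] allI)
    show "ennreal (exp (- (2 * real n * h))) \<le> bowen_M f (irregular_set f \<phi>) (h * (1 - 1 / real q)) \<epsilon> N" for N
      by (rule construction(2)) (use \<open>h > 0\<close> in auto)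
  qed (use \<epsilon>(1) in auto)
qed

text \<open>At exponent 0 every ball costs 1 and a nonempty set needs at least one. This makes the
  entropy of a nonempty set nonnegative, which settles targets \<open>z \<le> 0\<close>.\<close>

lemma one_le_bowen_M_0:
  assumes "Z \<noteq> {}"
  shows "1 \<le> bowen_M f Z 0 \<epsilon> N"
  unfolding bowen_M_def
proof (rule INF_greatest)
  fix \<Gamma> assume "\<Gamma> \<in> bowen_covers f Z \<epsilon> N"
  then obtain i where "i \<in> \<Gamma>"
    using assms by (fastforce simp: bowen_covers_def)
  then have "(\<Sum>\<^sub>\<infinity>i\<in>{i}. 1) \<le> (\<Sum>\<^sub>\<infinity>(n, x)\<in>\<Gamma>. ennreal (exp (- 0 * real n)))"
    by (intro infsum_mono_neutral nonneg_summable_on_complete) auto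
  then show "1 \<le> (\<Sum>\<^sub>\<infinity>(n, x)\<in>\<Gamma>. ennreal (exp (- 0 * real n)))"
    by simp
qed

theorem theorem4p1:
  fixes f :: "'a::metric_space \<Rightarrow> 'a" and \<phi> :: "'a \<Rightarrow> real"
  assumes "compact (UNIV :: 'a set)"
    and "continuous_on UNIV f"
    and "almost_specification f"
    and "continuous_on UNIV \<phi>"
    and "(INF \<mu>\<in>invariant_measures f. ereal (\<integral>x. \<phi> x \<partial>\<mu>))
           < (SUP \<mu>\<in>invariant_measures f. ereal (\<integral>x. \<phi> x \<partial>\<mu>))"
  shows "subset_entropy f (irregular_set f \<phi>) = topological_entropy f"
proof (rule antisym[OF subset_entropy_le_topological_entropy[OF assms(1)]], rule dense_le)
  \<comment> \<open>In the extended reals the strict inequality also excludes an empty family of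
    measures, whose infimum would be infinite.\<close>
  obtain \<mu>1 \<mu>2 where \<mu>: "\<mu>1 \<in> invariant_measures f" "\<mu>2 \<in> invariant_measures f"
    "(\<integral>x. \<phi> x \<partial>\<mu>1) < (\<integral>x. \<phi> x \<partial>\<mu>2)"
    using assms(5) by (auto simp: less_SUP_iff INF_less_iff)
  note lower = irregular_set_lower_bound[OF assms(1-4) \<mu>]
  let ?Z = "irregular_set f \<phi>"
  have at: "ereal \<alpha> \<le> subset_entropy f ?Z"
    if "\<epsilon> > 0" "C > 0" "\<And>N. C \<le> bowen_M f ?Z \<alpha> \<epsilon> N" for \<alpha> \<epsilon> C
  proof -
    have "ereal \<alpha> \<le> subset_entropy_at f ?Z \<epsilon>"
      using that(2,3) by (rule subset_entropy_at_ge)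
    also have "\<dots> \<le> subset_entropy f ?Z"
      unfolding subset_entropy_eq_SUP using that(1) by (intro SUP_upper) simp
    finally show ?thesis .
  qed
  fix z assume z: "z < topological_entropy f"
  obtain h' where h': "z < ereal h'" "ereal h' < topological_entropy f"
    using ereal_dense2[OF z] by blast
  show "z \<le> subset_entropy f ?Z"
  proof (cases "z \<le> 0")
    case True
    have "?Z \<noteq> {}"
      \<comment> \<open>Only nonemptiness is wanted here, so any \<open>h < h'\<close> and any
        positive \<open>q\<close> will do.\<close>
      using lower(1)[OF h'(2), of "h' - 1" 1] by simp
    then have "ereal 0 \<le> subset_entropy f ?Z"
      by (rule at[OF zero_less_one zero_less_one one_le_bowen_M_0])
    then show ?thesis
      using True by (simp add: zero_ereal_def order_trans)
  next
    case False
    then obtain H where H: "z = ereal H" "0 < H" "H < h'"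
      using h'(1) by (cases z) auto
    \<comment> \<open>The gap from \<open>h\<close> to \<open>h'\<close> pays for mistakes and
      pigeonhole, the gap from \<open>H\<close> to \<open>h\<close> for the filler blocks:
      \<open>q > h / (h - H)\<close> means exactly h(1 - 1/q) > H.\<close>
    define h where "h = (H + h') / 2"
    have h: "H < h" "h < h'"
      using H(3) by (simp_all add: h_def)
    obtain q :: nat where q: "h / (h - H) < real q"
      using reals_Archimedean2 by blast
    have "q > 0"
      using q h H(2) by (intro Nat.gr0I) (auto simp: divide_less_0_iff)
    have "H \<le> h * (1 - 1 / real q)"
      using q h \<open>q > 0\<close> by (simp add: field_simps)
    moreover have "ereal (h * (1 - 1 / real q)) \<le> subset_entropy f ?Z"
      using lower(2)[OF h'(2) h(2) \<open>q > 0\<close>] h(1) H(2) at by auto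
    ultimately show ?thesis
      unfolding H(1) by (metis ereal_less_eq(3) order_trans)
  qed
qed

end
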